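(* Let $G$ be a compact Lie group, $0<\alpha<1$, $p>1$, and let $(u_0,u_1)\in H^\alpha_{\mathcal{L}}(G)\times L^2(G)$ be a pair of nonnegative functions which is nontrivial, i.e. $(u_0,u_1)\neq(0,0)$. For $\varepsilon>0$ consider the Cauchy problem $$\begin{cases}\partial_t^2u+(-\mathcal{L})^\alpha u=|u|^p, & x\in G,\ t>0,\\ u(0,x)=\varepsilon u_0(x), & x\in G,\\ \partial_tu(0,x)=\varepsilon u_1(x), & x\in G.\end{cases}$$ Then there exist a constant $\varepsilon_0=\varepsilon_0(u_0,u_1,p)>0$ and a constant $C>0$ independent of $\varepsilon$ such that for every $\varepsilon\in(0,\varepsilon_0]$ the following holds: if $$u\in\mathcal{C}([0,T),H^\alpha_{\mathcal{L}}(G))\cap\mathcal{C}^1([0,T),L^2(G))\cap L^p_{\mathrm{loc}}([0,T)\times G)$$ is an energy solution to this Cauchy problem with lifespan $T=T(\varepsilon)$, then $u$ blows up in finite time (i.e. $T(\varepsilon)<\infty$), and the lifespan satisfies $$T(\varepsilon)\le C\,\varepsilon^{-\frac{p-1}{b(p)}},\qquad\text{where } b(p)=\begin{cases}p+1 & \text{if } u_1\neq0,\\ 2 & \text{if } u_1=0.\end{cases}$$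
   Context: $L^q(G)$ is taken with respect to the normalized Haar measure $dx$ on $G$. $\mathcal{L}$ is the Laplace-Beltrami operator on $G$; for every continuous irreducible unitary representation $\xi:G\to\mathbb{C}^{d_\xi\times d_\xi}$ one has $-\mathcal{L}\xi_{ij}=\lambda_\xi^2\xi_{ij}$ for all matrix coefficients, with $\lambda_\xi\ge0$, and for $s>0$ the fractional power $(-\mathcal{L})^s$ is defined by $\widehat{(-\mathcal{L})^sf}(\xi)=\lambda_\xi^{2s}\widehat{f}(\xi)$, where $\widehat{f}(\xi)=\int_Gf(x)\xi(x)^*\,dx$. The Sobolev space is $H^\alpha_{\mathcal{L}}(G)=\{f\in L^2(G):(-\mathcal{L})^{\alpha/2}f\in L^2(G)\}$ with norm $\|f\|_{L^2(G)}+\|(-\mathcal{L})^{\alpha/2}f\|_{L^2(G)}$. Energy solution: for $T>0$, a function $u\in\mathcal{C}([0,T),H^\alpha_{\mathcal{L}}(G))\cap\mathcal{C}^1([0,T),L^2(G))\cap L^p_{\mathrm{loc}}([0,T)\times G)$ is an energy solution on $[0,T)$ to the Cauchy problem if $$\int_G\partial_tu(t,x)\phi(t,x)\,dx-\int_Gu(t,x)(\partial_s\phi)(t,x)\,dx+\varepsilon\int_Gu_0(x)(\partial_s\phi)(0,x)\,dx-\varepsilon\int_Gu_1(x)\phi(0,x)\,dx$$ $$+\int_0^t\int_Gu(s,x)\left(\partial_s^2\phi(s,x)+(-\mathcal{L})^\alpha\phi(s,x)\right)dx\,ds=\int_0^t\int_G|u(s,x)|^p\phi(s,x)\,dx\,ds$$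 for every $\phi\in\mathcal{C}_0^\infty([0,T)\times G)$ and every $t\in(0,T)$. The lifespan of $u$ is its maximal existence time. *)

theory Defs
  imports
    "HOL-Analysis.Analysis"
    "HOL-Probability.Probability_Measure"
    "HOL-Algebra.Group"
    "Jordan_Normal_Form.Schur_Decomposition"
    "Jordan_Normal_Form.Gauss_Jordan_Elimination"
begin

section \<open>Smooth functions in coordinates\<close>

text \<open>
  The coordinate space R^n is the library's \<^const>\<open>Euclidean_space\<close> \<open>n\<close>: the functions
  \<open>z :: nat \<Rightarrow> real\<close> with \<open>z i = 0\<close> for \<open>i \<ge> n\<close>, with the product topology. The dimension is thus
  a number, and \<open>n = 0\<close> (finite groups) is not excluded.
\<close>

definition partial_deriv :: "nat \<Rightarrow> ((nat \<Rightarrow> real) \<Rightarrow> 'b::real_normed_vector) \<Rightarrow> (nat \<Rightarrow> real) \<Rightarrow> 'b"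
  where "partial_deriv i f z = vector_derivative (\<lambda>t. f (z(i := t))) (at (z i))"

text \<open>Both predicates below are meant for sets \<open>S\<close> that are open in \<open>Euclidean_space n\<close>.\<close>

primrec Ck_on :: "nat \<Rightarrow> nat \<Rightarrow> (nat \<Rightarrow> real) set \<Rightarrow> ((nat \<Rightarrow> real) \<Rightarrow> 'b::real_normed_vector) \<Rightarrow> bool"
  where
    "Ck_on n 0 S f \<longleftrightarrow> continuous_map (subtopology (Euclidean_space n) S) euclidean f"
  | "Ck_on n (Suc k) S f \<longleftrightarrow>
       continuous_map (subtopology (Euclidean_space n) S) euclidean f \<and>
       (\<forall>i<n. (\<forall>z\<in>S. (\<lambda>t. f (z(i := t))) differentiable (at (z i))) \<and>
              Ck_on n k S (partial_deriv i f))"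

definition smooth_on_coords ::
    "nat \<Rightarrow> (nat \<Rightarrow> real) set \<Rightarrow> ((nat \<Rightarrow> real) \<Rightarrow> 'b::real_normed_vector) \<Rightarrow> bool"
  where "smooth_on_coords n S f \<longleftrightarrow> (\<forall>k. Ck_on n k S f)"

section \<open>Compact Lie groups\<close>

text \<open>A chart is a domain together with a coordinate map defined on it.\<close>

type_synonym 'a chart = "'a set \<times> ('a \<Rightarrow> nat \<Rightarrow> real)"

definition chart_inv :: "'a chart \<Rightarrow> (nat \<Rightarrow> real) \<Rightarrow> 'a"
  where "chart_inv c = inv_into (fst c) (snd c)"

definition chart_image :: "'a chart \<Rightarrow> (nat \<Rightarrow> real) set"
  where "chart_image c = snd c ` fst c"

record 'a lie_group = "'a monoid" +
  top_of :: "'a topology"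
  dim_of :: nat
  atlas :: "'a chart set"

definition smooth_atlas :: "'a topology \<Rightarrow> nat \<Rightarrow> 'a chart set \<Rightarrow> bool"
  where "smooth_atlas X n A \<longleftrightarrow>
    (\<Union>c\<in>A. fst c) = topspace X \<and>
    (\<forall>c\<in>A. openin X (fst c) \<and> openin (Euclidean_space n) (chart_image c) \<and>
       homeomorphic_map (subtopology X (fst c)) (subtopology (Euclidean_space n) (chart_image c)) (snd c)) \<and>
    (\<forall>c\<in>A. \<forall>d\<in>A. \<forall>i<n.
       smooth_on_coords n (snd c ` (fst c \<inter> fst d)) (\<lambda>z. snd d (chart_inv c z) i))"

text \<open>
  In the smoothness condition on the multiplication the first \<open>n\<close> coordinates of a point of
  R^(n+n) belong to the left factor and the remaining ones to the right factor.
\<close>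

definition first_coords :: "nat \<Rightarrow> (nat \<Rightarrow> real) \<Rightarrow> nat \<Rightarrow> real"
  where "first_coords n z = (\<lambda>i. if i < n then z i else 0)"

definition drop_coords :: "nat \<Rightarrow> (nat \<Rightarrow> real) \<Rightarrow> nat \<Rightarrow> real"
  where "drop_coords n z = (\<lambda>i. z (n + i))"

definition smooth_mult :: "'a lie_group \<Rightarrow> bool"
  where "smooth_mult G \<longleftrightarrow>
    continuous_map (prod_topology (top_of G) (top_of G)) (top_of G) (\<lambda>(x, y). x \<otimes>\<^bsub>G\<^esub> y) \<and>
    (\<forall>c\<in>atlas G. \<forall>d\<in>atlas G. \<forall>e\<in>atlas G. \<forall>i<dim_of G.
       smooth_on_coords (dim_of G + dim_of G)
         {z \<in> topspace (Euclidean_space (dim_of G + dim_of G)).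
            first_coords (dim_of G) z \<in> chart_image c \<and> drop_coords (dim_of G) z \<in> chart_image d \<and>
            chart_inv c (first_coords (dim_of G) z) \<otimes>\<^bsub>G\<^esub> chart_inv d (drop_coords (dim_of G) z) \<in> fst e}
         (\<lambda>z. snd e (chart_inv c (first_coords (dim_of G) z) \<otimes>\<^bsub>G\<^esub>
                      chart_inv d (drop_coords (dim_of G) z)) i))"

definition smooth_inverse :: "'a lie_group \<Rightarrow> bool"
  where "smooth_inverse G \<longleftrightarrow>
    continuous_map (top_of G) (top_of G) (\<lambda>x. inv\<^bsub>G\<^esub> x) \<and>
    (\<forall>c\<in>atlas G. \<forall>d\<in>atlas G. \<forall>i<dim_of G.
       smooth_on_coords (dim_of G)
         {z \<in> chart_image c. inv\<^bsub>G\<^esub> (chart_inv c z) \<in> fst d}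
         (\<lambda>z. snd d (inv\<^bsub>G\<^esub> (chart_inv c z)) i))"

text \<open>Second countability is not listed: it follows from compactness and the charts.\<close>

definition compact_lie_group :: "'a lie_group \<Rightarrow> bool"
  where "compact_lie_group G \<longleftrightarrow>
    group G \<and> topspace (top_of G) = carrier G \<and>
    compact_space (top_of G) \<and> Hausdorff_space (top_of G) \<and>
    smooth_atlas (top_of G) (dim_of G) (atlas G) \<and>
    smooth_mult G \<and> smooth_inverse G"

definition normalized_haar_measure :: "'a lie_group \<Rightarrow> 'a measure \<Rightarrow> bool"
  where "normalized_haar_measure G M \<longleftrightarrow>
    prob_space M \<and> space M = carrier G \<and>
    sets M = sigma_sets (carrier G) {U. openin (top_of G) U} \<and>
    (\<forall>a\<in>carrier G. \<forall>S\<in>sets M. emeasure M ((\<lambda>x. a \<otimes>\<^bsub>G\<^esub> x) ` S) = emeasure M S)"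

section \<open>Laplace-Beltrami operator of a bi-invariant Riemannian metric\<close>

text \<open>
  A Riemannian metric is given by its component matrices: \<open>g c x\<close> is the matrix of the metric at
  the point \<open>x\<close> in the chart \<open>c\<close>. The last condition says that each map \<open>x \<mapsto> a x b\<close> is an isometry;
  for \<open>a = b = \<one>\<close> it is the transformation law of the components under a change of chart.
\<close>

type_synonym 'a metric_components = "'a chart \<Rightarrow> 'a \<Rightarrow> real mat"

definition translation_jacobian ::
    "'a lie_group \<Rightarrow> 'a \<Rightarrow> 'a \<Rightarrow> 'a chart \<Rightarrow> 'a chart \<Rightarrow> 'a \<Rightarrow> real mat"
  where "translation_jacobian G a b c d x =
    mat (dim_of G) (dim_of G) (\<lambda>(i, j).
      partial_deriv j (\<lambda>z. snd d (a \<otimes>\<^bsub>G\<^esub> chart_inv c z \<otimes>\<^bsub>G\<^esub> b) i) (snd c x))"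

definition bi_invariant_metric :: "'a lie_group \<Rightarrow> 'a metric_components \<Rightarrow> bool"
  where "bi_invariant_metric G g \<longleftrightarrow>
    (\<forall>c\<in>atlas G.
       (\<forall>x\<in>fst c.
          g c x \<in> carrier_mat (dim_of G) (dim_of G) \<and> transpose_mat (g c x) = g c x \<and>
          (\<forall>v :: nat \<Rightarrow> real. (\<exists>i<dim_of G. v i \<noteq> 0) \<longrightarrow>
             (\<Sum>i<dim_of G. \<Sum>j<dim_of G. v i * g c x $$ (i, j) * v j) > 0)) \<and>
       (\<forall>i<dim_of G. \<forall>j<dim_of G.
          smooth_on_coords (dim_of G) (chart_image c) (\<lambda>z. g c (chart_inv c z) $$ (i, j)))) \<and>
    (\<forall>c\<in>atlas G. \<forall>d\<in>atlas G. \<forall>a\<in>carrier G. \<forall>b\<in>carrier G. \<forall>x\<in>fst c.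
       a \<otimes>\<^bsub>G\<^esub> x \<otimes>\<^bsub>G\<^esub> b \<in> fst d \<longrightarrow>
       g c x = transpose_mat (translation_jacobian G a b c d x) *
               g d (a \<otimes>\<^bsub>G\<^esub> x \<otimes>\<^bsub>G\<^esub> b) * translation_jacobian G a b c d x)"

text \<open>
  In the chart \<open>c\<close>, with \<open>|g|\<close> the determinant and \<open>g^{ij}\<close> the inverse of the component matrix,
  div grad f = |g|^(-1/2) sum_{i,j} d_i (|g|^(1/2) g^{ij} d_j f).
  The value does not depend on the chart for twice differentiable \<open>f\<close>.
\<close>

definition laplace_beltrami_in_chart ::
    "'a lie_group \<Rightarrow> 'a metric_components \<Rightarrow> 'a chart \<Rightarrow> ('a \<Rightarrow> complex) \<Rightarrow> 'a \<Rightarrow> complex"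
  where "laplace_beltrami_in_chart G g c f x =
    (let n = dim_of G;
         vol = (\<lambda>z. sqrt (Determinant.det (g c (chart_inv c z))));
         ginv = (\<lambda>z i j. the (mat_inverse (g c (chart_inv c z))) $$ (i, j))
     in (\<Sum>i<n. \<Sum>j<n.
           partial_deriv i
             (\<lambda>z. (vol z * ginv z i j) *\<^sub>R partial_deriv j (\<lambda>y. f (chart_inv c y)) z) (snd c x))
        /\<^sub>R vol (snd c x))"

definition laplace_beltrami ::
    "'a lie_group \<Rightarrow> 'a metric_components \<Rightarrow> ('a \<Rightarrow> complex) \<Rightarrow> 'a \<Rightarrow> complex"
  where "laplace_beltrami G g f x =
    laplace_beltrami_in_chart G g (SOME c. c \<in> atlas G \<and> x \<in> fst c) f x"

section \<open>Representations and Fourier coefficients\<close>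

definition continuous_unitary_rep :: "'a lie_group \<Rightarrow> nat \<Rightarrow> ('a \<Rightarrow> complex mat) \<Rightarrow> bool"
  where "continuous_unitary_rep G d \<xi> \<longleftrightarrow>
    (\<forall>x\<in>carrier G. \<xi> x \<in> carrier_mat d d \<and> \<xi> x * mat_adjoint (\<xi> x) = 1\<^sub>m d) \<and>
    (\<forall>x\<in>carrier G. \<forall>y\<in>carrier G. \<xi> (x \<otimes>\<^bsub>G\<^esub> y) = \<xi> x * \<xi> y) \<and>
    (\<forall>i<d. \<forall>j<d. continuous_map (top_of G) euclidean (\<lambda>x. \<xi> x $$ (i, j)))"

definition irreducible_unitary_rep :: "'a lie_group \<Rightarrow> nat \<Rightarrow> ('a \<Rightarrow> complex mat) \<Rightarrow> bool"
  where "irreducible_unitary_rep G d \<xi> \<longleftrightarrow>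
    d > 0 \<and> continuous_unitary_rep G d \<xi> \<and>
    (\<forall>W. VectorSpace.subspace class_ring W (module_vec TYPE(complex) d) \<and>
         (\<forall>x\<in>carrier G. \<forall>w\<in>W. \<xi> x *\<^sub>v w \<in> W) \<longrightarrow>
         W = {0\<^sub>v d} \<or> W = carrier_vec d)"

definition rep_eigenvalue ::
    "'a lie_group \<Rightarrow> 'a metric_components \<Rightarrow> nat \<Rightarrow> ('a \<Rightarrow> complex mat) \<Rightarrow> real"
  where "rep_eigenvalue G g d \<xi> =
    (THE l. 0 \<le> l \<and>
       (\<forall>i<d. \<forall>j<d. \<forall>x\<in>carrier G.
          - laplace_beltrami G g (\<lambda>y. \<xi> y $$ (i, j)) x = complex_of_real (l\<^sup>2) * \<xi> x $$ (i, j)))"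

definition fourier_coeff ::
    "'a measure \<Rightarrow> nat \<Rightarrow> ('a \<Rightarrow> complex mat) \<Rightarrow> ('a \<Rightarrow> complex) \<Rightarrow> complex mat"
  where "fourier_coeff M d \<xi> f =
    mat d d (\<lambda>(i, j). LINT x|M. f x * mat_adjoint (\<xi> x) $$ (i, j))"

section \<open>Function spaces\<close>

text \<open>
  Elements of \<open>L\<^sup>2(G)\<close> are represented by functions; everything below is insensitive to
  changes on null sets.
\<close>

definition in_L2 :: "'a measure \<Rightarrow> ('a \<Rightarrow> complex) \<Rightarrow> bool"
  where "in_L2 M f \<longleftrightarrow> f \<in> borel_measurable M \<and> integrable M (\<lambda>x. (norm (f x))\<^sup>2)"

definition L2_norm_on :: "'a measure \<Rightarrow> ('a \<Rightarrow> complex) \<Rightarrow> real"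
  where "L2_norm_on M f = sqrt (LINT x|M. (norm (f x))\<^sup>2)"

text \<open>
  \<open>frac_laplacian G M g s f h\<close> says that \<open>h\<close> represents \<open>(-L)^s f\<close> in \<open>L\<^sup>2(G)\<close>. It is a relation because
  \<open>(-L)^s f\<close> is defined by its Fourier coefficients, that is, only up to equality almost everywhere.
\<close>

definition frac_laplacian ::
    "'a lie_group \<Rightarrow> 'a measure \<Rightarrow> 'a metric_components \<Rightarrow> real \<Rightarrow>
     ('a \<Rightarrow> complex) \<Rightarrow> ('a \<Rightarrow> complex) \<Rightarrow> bool"
  where "frac_laplacian G M g s f h \<longleftrightarrow>
    in_L2 M f \<and> in_L2 M h \<and>
    (\<forall>d \<xi>. irreducible_unitary_rep G d \<xi> \<longrightarrow>
       fourier_coeff M d \<xi> h =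
         complex_of_real (rep_eigenvalue G g d \<xi> powr (2 * s)) \<cdot>\<^sub>m fourier_coeff M d \<xi> f)"

definition in_sobolev ::
    "'a lie_group \<Rightarrow> 'a measure \<Rightarrow> 'a metric_components \<Rightarrow> real \<Rightarrow> ('a \<Rightarrow> complex) \<Rightarrow> bool"
  where "in_sobolev G M g \<alpha> f \<longleftrightarrow> in_L2 M f \<and> (\<exists>h. frac_laplacian G M g (\<alpha> / 2) f h)"

text \<open>The interval \<open>[0,T)\<close>, where \<open>T = \<infinity>\<close> is allowed.\<close>

definition time_interval :: "ereal \<Rightarrow> real set"
  where "time_interval T = {t. 0 \<le> t \<and> ereal t < T}"

text \<open>
  \<open>v t\<close> represents \<open>(-L)^(\<alpha>/2) u(t)\<close>, so that the expression under the limit is the Sobolev norm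
  of \<open>u(s) - u(t)\<close>.
\<close>

definition C0_sobolev ::
    "'a lie_group \<Rightarrow> 'a measure \<Rightarrow> 'a metric_components \<Rightarrow> real \<Rightarrow> ereal \<Rightarrow>
     (real \<Rightarrow> 'a \<Rightarrow> complex) \<Rightarrow> bool"
  where "C0_sobolev G M g \<alpha> T u \<longleftrightarrow>
    (\<exists>v. (\<forall>t\<in>time_interval T. frac_laplacian G M g (\<alpha> / 2) (u t) (v t)) \<and>
         (\<forall>t\<in>time_interval T.
            ((\<lambda>s. L2_norm_on M (\<lambda>x. u s x - u t x) + L2_norm_on M (\<lambda>x. v s x - v t x)) \<longlongrightarrow> 0)
              (at t within time_interval T)))"

text \<open>\<open>u \<in> C^1([0,T), L\<^sup>2(G))\<close> with \<open>\<partial>\<^sub>t u = w\<close> (one-sided at \<open>t = 0\<close>).\<close>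

definition C1_L2_deriv ::
    "'a measure \<Rightarrow> ereal \<Rightarrow> (real \<Rightarrow> 'a \<Rightarrow> complex) \<Rightarrow> (real \<Rightarrow> 'a \<Rightarrow> complex) \<Rightarrow> bool"
  where "C1_L2_deriv M T u w \<longleftrightarrow>
    (\<forall>t\<in>time_interval T. in_L2 M (u t) \<and> in_L2 M (w t) \<and>
       ((\<lambda>s. L2_norm_on M (\<lambda>x. (u s x - u t x) / complex_of_real (s - t) - w t x)) \<longlongrightarrow> 0)
         (at t within time_interval T) \<and>
       ((\<lambda>s. L2_norm_on M (\<lambda>x. w s x - w t x)) \<longlongrightarrow> 0) (at t within time_interval T))"

definition Lp_loc ::
    "'a lie_group \<Rightarrow> 'a measure \<Rightarrow> real \<Rightarrow> ereal \<Rightarrow> (real \<Rightarrow> 'a \<Rightarrow> complex) \<Rightarrow> bool"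
  where "Lp_loc G M p T u \<longleftrightarrow>
    (\<lambda>(t, x). u t x) \<in> borel_measurable (restrict_space lborel (time_interval T) \<Otimes>\<^sub>M M) \<and>
    (\<forall>K. compactin (prod_topology (top_of_set (time_interval T)) (top_of G)) K \<longrightarrow>
       set_integrable (lborel \<Otimes>\<^sub>M M) K (\<lambda>(t, x). norm (u t x) powr p))"

text \<open>
  Test functions on the manifold with boundary \<open>[0,T) \<times> G\<close>. As usual, smoothness up to the boundary
  means having a smooth extension across \<open>t = 0\<close>; \<open>\<phi>\<close> is such an extension to \<open>\<real> \<times> G\<close>, and only its
  values for \<open>t \<in> [0,T)\<close> matter. Coordinate 0 of R^(1+n) is time.
\<close>

definition test_function :: "'a lie_group \<Rightarrow> ereal \<Rightarrow> (real \<Rightarrow> 'a \<Rightarrow> complex) \<Rightarrow> bool"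
  where "test_function G T \<phi> \<longleftrightarrow>
    (\<forall>c\<in>atlas G.
       smooth_on_coords (Suc (dim_of G))
         {z \<in> topspace (Euclidean_space (Suc (dim_of G))). drop_coords 1 z \<in> chart_image c}
         (\<lambda>z. \<phi> (z 0) (chart_inv c (drop_coords 1 z)))) \<and>
    (\<exists>K. compactin (prod_topology (top_of_set (time_interval T)) (top_of G)) K \<and>
         (\<forall>t\<in>time_interval T. \<forall>x\<in>carrier G. (t, x) \<notin> K \<longrightarrow> \<phi> t x = 0))"

definition dt :: "(real \<Rightarrow> 'a \<Rightarrow> complex) \<Rightarrow> real \<Rightarrow> 'a \<Rightarrow> complex"
  where "dt \<phi> t x = vector_derivative (\<lambda>s. \<phi> s x) (at t)"

section \<open>Energy solutions and lifespan\<close>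

text \<open>
  In the integral identity \<open>w\<close> is \<open>\<partial>\<^sub>t u\<close> and \<open>\<psi> s\<close> is any representative of \<open>(-L)^\<alpha> \<phi>(s,\<cdot>)\<close>.
\<close>

definition energy_solution ::
    "'a lie_group \<Rightarrow> 'a measure \<Rightarrow> 'a metric_components \<Rightarrow> real \<Rightarrow> real \<Rightarrow> real \<Rightarrow>
     ('a \<Rightarrow> complex) \<Rightarrow> ('a \<Rightarrow> complex) \<Rightarrow> ereal \<Rightarrow> (real \<Rightarrow> 'a \<Rightarrow> complex) \<Rightarrow> bool"
  where "energy_solution G M g \<alpha> p \<epsilon> u0 u1 T u \<longleftrightarrow>
    0 < T \<and> C0_sobolev G M g \<alpha> T u \<and> Lp_loc G M p T u \<and>
    (\<exists>w. C1_L2_deriv M T u w \<and>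
      (\<forall>\<phi> \<psi>. test_function G T \<phi> \<and>
        (\<forall>s\<in>time_interval T. frac_laplacian G M g \<alpha> (\<phi> s) (\<psi> s)) \<longrightarrow>
        (\<forall>t. 0 < t \<and> ereal t < T \<longrightarrow>
          (LINT x|M. w t x * \<phi> t x) - (LINT x|M. u t x * dt \<phi> t x)
          + complex_of_real \<epsilon> * (LINT x|M. u0 x * dt \<phi> 0 x)
          - complex_of_real \<epsilon> * (LINT x|M. u1 x * \<phi> 0 x)
          + (LINT s:{0..t}|lborel. (LINT x|M. u s x * (dt (dt \<phi>) s x + \<psi> s x)))
          = (LINT s:{0..t}|lborel. (LINT x|M. complex_of_real (norm (u s x) powr p) * \<phi> s x)))))"

text \<open>\<open>u\<close> is an energy solution on \<open>[0,T)\<close> which cannot be continued beyond \<open>T\<close>.\<close>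

definition energy_solution_with_lifespan ::
    "'a lie_group \<Rightarrow> 'a measure \<Rightarrow> 'a metric_components \<Rightarrow> real \<Rightarrow> real \<Rightarrow> real \<Rightarrow>
     ('a \<Rightarrow> complex) \<Rightarrow> ('a \<Rightarrow> complex) \<Rightarrow> ereal \<Rightarrow> (real \<Rightarrow> 'a \<Rightarrow> complex) \<Rightarrow> bool"
  where "energy_solution_with_lifespan G M g \<alpha> p \<epsilon> u0 u1 T u \<longleftrightarrow>
    energy_solution G M g \<alpha> p \<epsilon> u0 u1 T u \<and>
    (\<forall>T' v. energy_solution G M g \<alpha> p \<epsilon> u0 u1 T' v \<and>
       (\<forall>t\<in>time_interval (min T T'). AE x in M. v t x = u t x) \<longrightarrow> T' \<le> T)"

definition lifespan_exponent :: "'a measure \<Rightarrow> ('a \<Rightarrow> complex) \<Rightarrow> real \<Rightarrow> real"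
  where "lifespan_exponent M u1 p = (if AE x in M. u1 x = 0 then 2 else p + 1)"

end

theory Submission
  imports Defs
begin

text \<open>
  The proof replaces the equation on \<open>G\<close> by an ordinary differential inequality for the mean
  \<open>V(t) = \<integral> u(t,x) dx\<close>. A test function \<open>\<phi>(t,x) = \<theta>(t)\<close> that does not depend on \<open>x\<close>
  removes the fractional Laplacian: by invariance of Haar measure the integral of a nontrivial
  irreducible representation is zero, and the eigenvalue of the trivial one is zero
  (\<open>frac_laplacian_constant\<close>). For given \<open>\<tau>\<close>, the choice \<open>\<theta>(s) = \<tau> - s\<close> on
  \<open>[0,\<tau>]\<close>, cut off smoothly between \<open>\<tau>\<close> and \<open>T\<close>, turns the energy identity at time
  \<open>\<tau>\<close> into
    \<open>V(\<tau>) = \<epsilon> \<integral> u0 + \<epsilon> \<tau> \<integral> u1\<close> + the integral of \<open>(\<tau> - s) N(s)\<close> over \<open>[0,\<tau>]\<close>,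
  where \<open>N(s) = \<integral> |u(s,x)|^p dx\<close> (\<open>energy_solution_mean_identity\<close>). From here on \<open>V\<close>
  stands for its real part, which is positive.

  Since \<open>G\<close> has measure one, Jensen's inequality gives \<open>N(s) \<ge> V(s)^p\<close>, and since
  \<open>V\<close> is nondecreasing, \<open>V(t + h) \<ge> V(t) + V(t)^p h^2 / 2\<close>. From a value
  \<open>v\<close> the mean therefore doubles within a time proportional to \<open>v^(-(p-1)/2)\<close>. These doubling
  times are summable, so the solution lives at most for a time of order \<open>t0 + V(t0)^(-(p-1)/2)\<close>
  (\<open>existence_time_le_sum_of_doubling_times\<close>).

  It remains to choose \<open>t0\<close>. If \<open>u1 = 0\<close> then \<open>V \<ge> \<epsilon> a\<close> with \<open>a = \<integral> u0 > 0\<close>, and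
  \<open>t0 = (\<epsilon> a)^(-(p-1)/2)\<close> gives the exponent \<open>(p-1)/2\<close>. If \<open>u1 \<noteq> 0\<close> then
  \<open>V(t0) \<ge> \<epsilon> b t0\<close> with \<open>b = \<integral> u1 > 0\<close>, and the two terms balance at
  \<open>t0 = (\<epsilon> b)^(-(p-1)/(p+1))\<close>.
\<close>

section \<open>Smooth cutoff functions on the line\<close>

text \<open>
  The recursion asks for a derivative at every point, so that the sum, product and chain rules
  carry over by induction on the order.
\<close>

primrec Ck_real :: "nat \<Rightarrow> (real \<Rightarrow> real) \<Rightarrow> bool"
  where
    "Ck_real 0 h \<longleftrightarrow> continuous_on UNIV h"
  | "Ck_real (Suc k) h \<longleftrightarrow>
       (\<exists>h'. (\<forall>x. (h has_real_derivative h' x) (at x)) \<and> Ck_real k h')"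

lemma Ck_real_SucI:
  assumes "\<And>x. (h has_real_derivative h' x) (at x)" "Ck_real k h'"
  shows "Ck_real (Suc k) h"
  using assms by auto

lemma Ck_real_continuous: "Ck_real k h \<Longrightarrow> continuous_on UNIV h"
  by (cases k) (auto intro!: continuous_at_imp_continuous_on intro: DERIV_isCont)

lemma Ck_real_lower: "Ck_real (Suc k) h \<Longrightarrow> Ck_real k h"
proof (induction k arbitrary: h)
  case 0
  then show ?case using Ck_real_continuous[of "Suc 0" h] by simp
next
  case (Suc k)
  from Suc.prems obtain h' where
    h': "\<And>x. (h has_real_derivative h' x) (at x)" "Ck_real (Suc k) h'"
    unfolding Ck_real.simps(2)[of "Suc k"] by blast
  show ?case by (rule Ck_real_SucI[OF h'(1) Suc.IH[OF h'(2)]])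
qed

lemma Ck_real_const: "Ck_real k (\<lambda>_. c)"
proof (induction k arbitrary: c)
  case (Suc k)
  show ?case by (rule Ck_real_SucI[OF DERIV_const Suc.IH])
qed auto

lemma Ck_real_affine: "Ck_real k (\<lambda>x. c * x + d)"
proof (cases k)
  case (Suc l)
  show ?thesis
    unfolding Suc
    by (rule Ck_real_SucI[OF _ Ck_real_const[of l c]]) (auto intro!: derivative_eq_intros)
qed (auto intro!: continuous_intros)

lemma Ck_real_add: "Ck_real k f \<Longrightarrow> Ck_real k h \<Longrightarrow> Ck_real k (\<lambda>x. f x + h x)"
proof (induction k arbitrary: f h)
  case (Suc k)
  from Suc.prems obtain f' h' where
    "\<And>x. (f has_real_derivative f' x) (at x)" "Ck_real k f'"
    "\<And>x. (h has_real_derivative h' x) (at x)" "Ck_real k h'" by auto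
  then show ?case
    by (intro Ck_real_SucI[of _ "\<lambda>x. f' x + h' x"] Suc.IH DERIV_add)
qed (auto intro!: continuous_intros)

lemma Ck_real_mult: "Ck_real k f \<Longrightarrow> Ck_real k h \<Longrightarrow> Ck_real k (\<lambda>x. f x * h x)"
proof (induction k arbitrary: f h)
  case (Suc k)
  from Suc.prems obtain f' h' where
    d: "\<And>x. (f has_real_derivative f' x) (at x)" "Ck_real k f'"
    "\<And>x. (h has_real_derivative h' x) (at x)" "Ck_real k h'" by auto
  have "Ck_real k (\<lambda>x. f' x * h x + f x * h' x)"
    by (rule Ck_real_add[OF Suc.IH[OF d(2) Ck_real_lower] Suc.IH[OF Ck_real_lower d(4)]])
      (rule Suc.prems)+
  then show ?case
    by (rule Ck_real_SucI[rotated]) (rule DERIV_cong[OF DERIV_mult[OF d(1) d(3)]], simp)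
qed (auto intro!: continuous_intros)

lemma Ck_real_compose: "Ck_real k f \<Longrightarrow> Ck_real k h \<Longrightarrow> Ck_real k (\<lambda>x. f (h x))"
proof (induction k arbitrary: f h)
  case 0
  then show ?case by (auto intro: continuous_on_compose2)
next
  case (Suc k)
  from Suc.prems obtain f' h' where
    d: "\<And>x. (f has_real_derivative f' x) (at x)" "Ck_real k f'"
    "\<And>x. (h has_real_derivative h' x) (at x)" "Ck_real k h'" by auto
  have "Ck_real k (\<lambda>x. f' (h x) * h' x)"
    by (rule Ck_real_mult[OF Suc.IH[OF d(2) Ck_real_lower] d(4)]) (rule Suc.prems)
  then show ?case
    by (rule Ck_real_SucI[rotated]) (rule DERIV_chain2[OF d(1) d(3)])
qed

text \<open>
  The powers of \<open>1/x\<close> are there because differentiating \<open>exp(-1/x)\<close> produces them: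
  the family is closed under differentiation up to linear combinations, and smoothness of all its
  members follows by one induction.
\<close>

definition flat_exp :: "nat \<Rightarrow> real \<Rightarrow> real"
  where "flat_exp n x = (if 0 < x then inverse x ^ n * exp (- inverse x) else 0)"

lemma flat_exp_tendsto_0: "(flat_exp n \<longlongrightarrow> 0) (at 0)"
proof -
  have "((\<lambda>x. inverse x ^ n / exp (inverse x)) \<longlongrightarrow> (0::real)) (at_right 0)"
    by (rule filterlim_compose[OF tendsto_power_div_exp_0 filterlim_inverse_at_top_right])
  moreover have "eventually (\<lambda>x. inverse x ^ n / exp (inverse x) = flat_exp n x) (at_right 0)"
    by (auto simp: eventually_at_filter flat_exp_def exp_minus field_simps)
  ultimately have "(flat_exp n \<longlongrightarrow> 0) (at_right 0)"
    by (rule Lim_transform_eventually)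
  moreover have "(flat_exp n \<longlongrightarrow> 0) (at_left 0)"
    by (rule Lim_transform_eventually[of "\<lambda>_. 0"])
      (auto simp: eventually_at_filter flat_exp_def)
  ultimately show ?thesis by (simp add: filterlim_at_split)
qed

lemma flat_exp_has_derivative:
  "(flat_exp n has_real_derivative flat_exp (n + 2) x - real n * flat_exp (n + 1) x) (at x)"
proof -
  consider "x < 0" | "x = 0" | "0 < x" by linarith
  then show ?thesis
  proof cases
    case 1
    have "((\<lambda>_. 0) has_real_derivative 0) (at x)" by simp
    then have "(flat_exp n has_real_derivative 0) (at x)"
      by (rule has_field_derivative_transform_within_open[where S = "{..<0}"]) (use 1 in \<open>auto simp: flat_exp_def\<close>)
    then show ?thesis using 1 by (simp add: flat_exp_def)
  next
    case 2
    have "(flat_exp n y - flat_exp n 0) / (y - 0) = flat_exp (Suc n) y" for y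
      by (auto simp: flat_exp_def field_simps)
    then have "((\<lambda>y. (flat_exp n y - flat_exp n 0) / (y - 0)) \<longlongrightarrow> 0) (at 0)"
      using flat_exp_tendsto_0[of "Suc n"] by simp
    then have "(flat_exp n has_real_derivative 0) (at 0)"
      by (simp add: has_field_derivative_iff)
    then show ?thesis using 2 by (simp add: flat_exp_def)
  next
    case 3
    have "((\<lambda>x. inverse x ^ n * exp (- inverse x)) has_real_derivative
        real n * inverse x ^ (n - 1) * (- (inverse x * inverse x)) * exp (- inverse x) +
        inverse x ^ n * (exp (- inverse x) * (inverse x * inverse x))) (at x)"
      using 3 by (auto intro!: derivative_eq_intros simp: numeral_2_eq_2)
    also have "real n * inverse x ^ (n - 1) * (- (inverse x * inverse x)) * exp (- inverse x) +
        inverse x ^ n * (exp (- inverse x) * (inverse x * inverse x)) =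
        flat_exp (n + 2) x - real n * flat_exp (n + 1) x"
      using 3 by (cases n) (simp_all add: flat_exp_def algebra_simps)
    finally have "((\<lambda>x. inverse x ^ n * exp (- inverse x)) has_real_derivative
        flat_exp (n + 2) x - real n * flat_exp (n + 1) x) (at x)" .
    then show ?thesis
      by (rule has_field_derivative_transform_within_open[where S = "{0<..}"]) (use 3 in \<open>auto simp: flat_exp_def\<close>)
  qed
qed

lemma Ck_real_flat_exp: "Ck_real k (flat_exp n)"
proof (induction k arbitrary: n)
  case 0
  show ?case
    by (auto intro!: continuous_at_imp_continuous_on DERIV_isCont flat_exp_has_derivative)
next
  case (Suc k)
  have "Ck_real k (\<lambda>x. flat_exp (n + 2) x + (- real n) * flat_exp (n + 1) x)"
    by (rule Ck_real_add[OF Suc.IH Ck_real_mult[OF Ck_real_const Suc.IH]])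
  then show ?case
    by (rule Ck_real_SucI[rotated]) (use flat_exp_has_derivative[of n] in simp)
qed

text \<open>
  With \<open>f = flat_exp 0\<close>, which vanishes on the negative half line and increases on the positive
  one, the function \<open>f (f (b - a) - f (s - a))\<close> is a positive constant for \<open>s \<le> a\<close> and zero for
  \<open>s \<ge> b\<close>. A composition thus does the work for which one usually divides or integrates.
\<close>

lemma smooth_cutoff_exists:
  fixes a b :: real
  assumes "a < b"
  shows "\<exists>\<eta>. (\<forall>k. Ck_real k \<eta>) \<and> (\<forall>s\<le>a. \<eta> s = 1) \<and> (\<forall>s\<ge>b. \<eta> s = 0)"
proof -
  define f where "f = flat_exp 0"
  define c where "c = f (b - a)"
  have f_pos: "0 < f x" if "0 < x" for x using that by (simp add: f_def flat_exp_def)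
  have f_0: "f x = 0" if "x \<le> 0" for x using that by (simp add: f_def flat_exp_def)
  have c: "0 < c" unfolding c_def using assms by (intro f_pos) auto
  define \<eta> where "\<eta> s = inverse (f c) * f (c + (- 1) * f (1 * s + (- a)))" for s
  have "Ck_real k \<eta>" for k
    unfolding \<eta>_def f_def
    by (rule Ck_real_mult[OF Ck_real_const Ck_real_compose[OF Ck_real_flat_exp
          Ck_real_add[OF Ck_real_const Ck_real_mult[OF Ck_real_const
            Ck_real_compose[OF Ck_real_flat_exp Ck_real_affine]]]]])
  moreover have "\<eta> s = 1" if "s \<le> a" for s
    using that f_pos[OF c] by (simp add: \<eta>_def f_0)
  moreover have "\<eta> s = 0" if "b \<le> s" for s
  proof -
    have "c \<le> f (s - a)"
      using that assms by (auto simp: c_def f_def flat_exp_def intro!: le_imp_inverse_le)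
    then show ?thesis by (simp add: \<eta>_def f_0)
  qed
  ultimately show ?thesis by blast
qed

section \<open>Blow-up of superlinear growth\<close>

text \<open>
  Once \<open>V\<close> has reached the size \<open>2^k * V0\<close>, it doubles within the time
  \<open>2 * (2^k * V0) powr -((p - 1) / 2)\<close>. These times form a geometric series, so all doublings would
  happen before its sum, after which no finite value of \<open>V\<close> remains.
\<close>

lemma existence_time_le_sum_of_doubling_times:
  fixes V :: "real \<Rightarrow> real" and p t0 V0 :: real and T :: ereal
  assumes p: "1 < p" and V0: "0 < V0" "V0 \<le> V t0"
    and growth: "\<And>t h. \<lbrakk>t0 \<le> t; 0 < h; ereal (t + h) < T; 0 < V t\<rbrakk> \<Longrightarrow>
      V t + V t powr p * h\<^sup>2 / 2 \<le> V (t + h)"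
  shows "T \<le> ereal (t0 + 2 / (1 - 2 powr - ((p - 1) / 2)) * V0 powr - ((p - 1) / 2))"
proof (rule ccontr)
  define q where "q = (p - 1) / 2"
  have q: "0 < q" "p = 1 + 2 * q" using p by (auto simp: q_def field_simps)
  define r where "r = 2 powr - q"
  have r: "0 < r" "r < 1" using q powr_less_mono[of "- q" 0 2] by (auto simp: r_def)
  define h where "h k = 2 * V0 powr - q * r ^ k" for k :: nat
  define \<tau> where "\<tau> k = t0 + (\<Sum>j<k. h j)" for k
  define S where "S = t0 + 2 / (1 - r) * V0 powr - q"
  assume "\<not> ?thesis"
  then have S: "ereal S < T" by (simp add: S_def r_def q_def)
  have h_pos: "0 < h k" for k using r V0 by (simp add: h_def)
  have \<tau>_ge: "t0 \<le> \<tau> k" for k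
    unfolding \<tau>_def using h_pos by (simp add: sum_nonneg less_imp_le)
  have \<tau>_less: "\<tau> k < S" for k
  proof -
    have "(\<Sum>j<k. h j) = 2 * V0 powr - q * ((1 - r ^ k) / (1 - r))"
      using r by (simp add: h_def sum_distrib_left[symmetric] sum_gp_strict)
    also have "\<dots> < 2 * V0 powr - q * (1 / (1 - r))"
      using r V0 by (intro mult_strict_left_mono divide_strict_right_mono) auto
    finally show ?thesis by (simp add: \<tau>_def S_def)
  qed
  have h_sq: "h k ^ 2 / 2 = 2 * (2 ^ k * V0) powr - (2 * q)" for k
  proof -
    have "h k ^ 2 / 2 = 2 * (V0 powr - q * r ^ k)\<^sup>2"
      by (simp add: h_def power_mult_distrib)
    also have "V0 powr - q * r ^ k = (2 ^ k * V0) powr - q"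
      using V0 by (simp add: r_def powr_mult powr_powr flip: powr_realpow)
        (simp add: powr_powr mult.commute)
    also have "\<dots>\<^sup>2 = (2 ^ k * V0) powr - (2 * q)"
      using V0 by (simp add: powr_power mult.commute)
    finally show ?thesis .
  qed
  have doubling: "2 ^ k * V0 \<le> V (\<tau> k)" for k
  proof (induction k)
    case 0
    show ?case using V0 by (simp add: \<tau>_def)
  next
    case (Suc k)
    let ?v = "V (\<tau> k)"
    have pos: "0 < 2 ^ k * V0" using V0 by simp
    then have v: "0 < ?v" using Suc by linarith
    have \<tau>_Suc: "\<tau> (Suc k) = \<tau> k + h k" by (simp add: \<tau>_def)
    have "2 * ?v \<le> ?v powr p * (2 * (2 ^ k * V0) powr - (2 * q))"
    proof -
      have "(2 ^ k * V0) powr (2 * q) \<le> ?v powr (2 * q)"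
        using Suc pos q by (intro powr_mono2) auto
      then have "1 \<le> ?v powr (2 * q) * (2 ^ k * V0) powr - (2 * q)"
        using V0(1)
        by (simp add: powr_minus_divide)
      then have "?v * 1 \<le> ?v * (?v powr (2 * q) * (2 ^ k * V0) powr - (2 * q))"
        using v by (intro mult_left_mono) auto
      moreover have "?v powr p = ?v * ?v powr (2 * q)"
        using v by (simp add: q(2) powr_add)
      ultimately show ?thesis by (simp add: mult_ac)
    qed
    moreover have "?v + ?v powr p * (h k)\<^sup>2 / 2 \<le> V (\<tau> (Suc k))"
      unfolding \<tau>_Suc
    proof (rule growth[OF \<tau>_ge h_pos _ v])
      have "\<tau> k + h k < S" using \<tau>_less[of "Suc k"] by (simp add: \<tau>_Suc)
      then show "ereal (\<tau> k + h k) < T" using S by (metis ereal_less_eq(3) le_less_trans less_imp_le)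
    qed
    ultimately have "2 * ?v \<le> V (\<tau> (Suc k))" using h_sq[of k] v by (simp add: mult_ac)
    then show ?case using Suc by simp
  qed
  have "2 ^ k * V0 \<le> V S" for k
  proof -
    have v: "0 < V (\<tau> k)" using doubling[of k] V0 by (smt (verit) mult_pos_pos zero_less_power)
    have "V (\<tau> k) + V (\<tau> k) powr p * (S - \<tau> k)\<^sup>2 / 2 \<le> V S"
      using growth[OF \<tau>_ge[of k], of "S - \<tau> k"] \<tau>_less[of k] S v by simp
    moreover have "0 \<le> V (\<tau> k) powr p * (S - \<tau> k)\<^sup>2 / 2" by simp
    ultimately show ?thesis using doubling[of k] by linarith
  qed
  then have "2 ^ k \<le> V S / V0" for k using V0 by (simp add: field_simps)
  moreover obtain k where "V S / V0 < 2 ^ k" using real_arch_pow[of 2 "V S / V0"] by auto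
  ultimately show False by (meson not_le)
qed

section \<open>The fractional Laplacian of constants\<close>

lemma continuous_map_fun_upd_Euclidean_space:
  assumes "z \<in> topspace (Euclidean_space n)" "i < n"
  shows "continuous_map euclidean (Euclidean_space n) (\<lambda>t. z(i := t))"
proof -
  have "continuous_map euclideanreal (powertop_real UNIV) (\<lambda>t. z(i := t))"
    unfolding continuous_map_componentwise_UNIV by (auto simp: fun_upd_def)
  then show ?thesis
    using assms
    by (auto simp: Euclidean_space_def continuous_map_in_subtopology)
qed

lemma partial_deriv_locally_constant:
  assumes S: "openin (Euclidean_space n) S" and "z \<in> S" "i < n"
    and f: "\<And>y. y \<in> S \<Longrightarrow> f y = c"
  shows "partial_deriv i f z = 0"
proof -
  let ?U = "{t. z(i := t) \<in> S}"
  have z: "z \<in> topspace (Euclidean_space n)" using S \<open>z \<in> S\<close> openin_subset by blast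
  have "openin euclideanreal {t \<in> topspace euclideanreal. z(i := t) \<in> S}"
    using continuous_map_fun_upd_Euclidean_space[OF z \<open>i < n\<close>] S
    by (rule openin_continuous_map_preimage)
  then have U: "open ?U" by simp
  have "((\<lambda>_. c) has_vector_derivative 0) (at (z i))" by simp
  then have "((\<lambda>t. f (z(i := t))) has_vector_derivative 0) (at (z i))"
    by (rule has_vector_derivative_transform_within_open[OF _ U])
      (use \<open>z \<in> S\<close> f in auto)
  then show ?thesis by (simp add: partial_deriv_def vector_derivative_at)
qed

lemma laplace_beltrami_constant:
  assumes G: "compact_lie_group G" and x: "x \<in> carrier G"
    and f: "\<And>y. y \<in> carrier G \<Longrightarrow> f y = c"
  shows "laplace_beltrami G g f x = 0"
proof -
  have top: "topspace (top_of G) = carrier G"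
    and atlas: "smooth_atlas (top_of G) (dim_of G) (atlas G)"
    using G by (auto simp: compact_lie_group_def)
  define e where "e = (SOME e. e \<in> atlas G \<and> x \<in> fst e)"
  have "x \<in> (\<Union>e\<in>atlas G. fst e)"
    using atlas x top by (simp add: smooth_atlas_def)
  then have "\<exists>e. e \<in> atlas G \<and> x \<in> fst e" by blast
  then have "e \<in> atlas G \<and> x \<in> fst e" unfolding e_def by (rule someI_ex)
  then have e: "e \<in> atlas G" "x \<in> fst e" by auto
  then have op: "openin (Euclidean_space (dim_of G)) (chart_image e)"
    and "openin (top_of G) (fst e)"
    using atlas by (auto simp: smooth_atlas_def)
  then have sub: "fst e \<subseteq> carrier G" using openin_subset top by metis
  have inv: "chart_inv e z \<in> carrier G" if "z \<in> chart_image e" for z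
    using that sub by (auto simp: chart_inv_def chart_image_def inv_into_into subset_iff)
  have 1: "partial_deriv j (\<lambda>y. f (chart_inv e y)) z = 0"
    if "z \<in> chart_image e" "j < dim_of G" for j z
    by (rule partial_deriv_locally_constant[OF op that, of _ c]) (simp add: f inv)
  have 2: "partial_deriv i (\<lambda>z. a z *\<^sub>R partial_deriv j (\<lambda>y. f (chart_inv e y)) z) (snd e x) = 0"
    if "i < dim_of G" "j < dim_of G" for i j a
    by (rule partial_deriv_locally_constant[OF op _ that(1), of _ _ 0])
      (use e 1 that in \<open>auto simp: chart_image_def\<close>)
  show ?thesis
    unfolding laplace_beltrami_def e_def[symmetric] laplace_beltrami_in_chart_def Let_def
    by (simp add: 2)
qed

lemma continuous_map_borel_measurable_haar:
  fixes f :: "'a \<Rightarrow> complex"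
  assumes G: "compact_lie_group G" and M: "normalized_haar_measure G M"
    and f: "continuous_map (top_of G) euclidean f"
  shows "f \<in> borel_measurable M"
proof (rule borel_measurableI)
  fix S :: "complex set" assume "open S"
  then have "openin (top_of G) {x \<in> topspace (top_of G). f x \<in> S}"
    by (intro openin_continuous_map_preimage[OF f]) simp
  moreover have "{x \<in> topspace (top_of G). f x \<in> S} = f -` S \<inter> space M"
    using G M by (auto simp: compact_lie_group_def normalized_haar_measure_def)
  ultimately show "f -` S \<inter> space M \<in> sets M"
    using M by (auto simp: normalized_haar_measure_def intro: sigma_sets.Basic)
qed

lemma continuous_map_integrable_haar:
  fixes f :: "'a \<Rightarrow> complex"
  assumes G: "compact_lie_group G" and M: "normalized_haar_measure G M"
    and f: "continuous_map (top_of G) euclidean f"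
  shows "integrable M f"
proof -
  interpret prob_space M using M by (simp add: normalized_haar_measure_def)
  have "compactin (top_of G) (topspace (top_of G))"
    using G by (auto simp: compact_lie_group_def compact_space_def)
  then have "compactin euclidean (f ` topspace (top_of G))"
    using f by (rule image_compactin)
  then have "bounded (f ` topspace (top_of G))" by (simp add: compact_imp_bounded)
  then obtain B where "\<And>x. x \<in> topspace (top_of G) \<Longrightarrow> norm (f x) \<le> B"
    unfolding bounded_iff by auto
  then have "AE x in M. norm (f x) \<le> B"
    using G M by (auto simp: compact_lie_group_def normalized_haar_measure_def)
  then show ?thesis
    using continuous_map_borel_measurable_haar[OF G M f] by (rule integrable_const_bound)
qed

lemma haar_integral_left_translate:
  fixes f :: "'a \<Rightarrow> complex"
  assumes G: "compact_lie_group G" and M: "normalized_haar_measure G M"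
    and a: "a \<in> carrier G" and f: "f \<in> borel_measurable M"
  shows "(LINT x|M. f (a \<otimes>\<^bsub>G\<^esub> x)) = (LINT x|M. f x)"
proof -
  interpret group G using G by (simp add: compact_lie_group_def)
  have sp: "space M = carrier G" and
    se: "sets M = sigma_sets (carrier G) {U. openin (top_of G) U}" and
    top: "topspace (top_of G) = carrier G" and
    left_inv: "\<And>a S. a \<in> carrier G \<Longrightarrow> S \<in> sets M \<Longrightarrow>
      emeasure M ((\<lambda>x. a \<otimes>\<^bsub>G\<^esub> x) ` S) = emeasure M S"
    using G M by (auto simp: compact_lie_group_def normalized_haar_measure_def)
  have cont: "continuous_map (top_of G) (top_of G) (\<lambda>x. a \<otimes>\<^bsub>G\<^esub> x)"
  proof -
    have "continuous_map (top_of G) (prod_topology (top_of G) (top_of G)) (\<lambda>x. (a, x))"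
      using a top by (auto intro!: continuous_map_pairedI)
    moreover have "continuous_map (prod_topology (top_of G) (top_of G)) (top_of G)
        (\<lambda>(x, y). x \<otimes>\<^bsub>G\<^esub> y)"
      using G by (simp add: compact_lie_group_def smooth_mult_def)
    ultimately have "continuous_map (top_of G) (top_of G) ((\<lambda>(x, y). x \<otimes>\<^bsub>G\<^esub> y) \<circ> (\<lambda>x. (a, x)))"
      by (rule continuous_map_compose)
    then show ?thesis by (simp add: comp_def)
  qed
  have meas: "(\<lambda>x. a \<otimes>\<^bsub>G\<^esub> x) \<in> measurable M M"
  proof (rule measurable_sigma_sets[OF se])
    show "{U. openin (top_of G) U} \<subseteq> Pow (carrier G)" using openin_subset top by fastforce
    show "(\<lambda>x. a \<otimes>\<^bsub>G\<^esub> x) \<in> space M \<rightarrow> carrier G" using a sp by auto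
    fix U assume "U \<in> {U. openin (top_of G) U}"
    then have "openin (top_of G) {x \<in> topspace (top_of G). a \<otimes>\<^bsub>G\<^esub> x \<in> U}"
      by (intro openin_continuous_map_preimage[OF cont]) simp
    moreover have "{x \<in> topspace (top_of G). a \<otimes>\<^bsub>G\<^esub> x \<in> U} = (\<lambda>x. a \<otimes>\<^bsub>G\<^esub> x) -` U \<inter> space M"
      using sp top by auto
    ultimately show "(\<lambda>x. a \<otimes>\<^bsub>G\<^esub> x) -` U \<inter> space M \<in> sets M"
      by (auto simp: se intro: sigma_sets.Basic)
  qed
  have "distr M M (\<lambda>x. a \<otimes>\<^bsub>G\<^esub> x) = M"
  proof (rule measure_eqI)
    fix S assume "S \<in> sets (distr M M (\<lambda>x. a \<otimes>\<^bsub>G\<^esub> x))"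
    then have S: "S \<in> sets M" by simp
    then have S_sub: "S \<subseteq> carrier G" using sets.sets_into_space sp by auto
    \<comment> \<open>The preimage under translation by \<open>a\<close> is the image under translation by the inverse of \<open>a\<close>.\<close>
    have "(\<lambda>x. a \<otimes>\<^bsub>G\<^esub> x) -` S \<inter> space M = (\<lambda>x. inv\<^bsub>G\<^esub> a \<otimes>\<^bsub>G\<^esub> x) ` S"
    proof (intro equalityI subsetI)
      fix x assume "x \<in> (\<lambda>x. a \<otimes>\<^bsub>G\<^esub> x) -` S \<inter> space M"
      then have x: "a \<otimes>\<^bsub>G\<^esub> x \<in> S" "x \<in> carrier G" by (simp_all add: sp)
      have "x = inv\<^bsub>G\<^esub> a \<otimes>\<^bsub>G\<^esub> (a \<otimes>\<^bsub>G\<^esub> x)" using x a by (simp add: m_assoc[symmetric])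
      then show "x \<in> (\<lambda>x. inv\<^bsub>G\<^esub> a \<otimes>\<^bsub>G\<^esub> x) ` S" using x(1) by (rule image_eqI)
    next
      fix x assume "x \<in> (\<lambda>x. inv\<^bsub>G\<^esub> a \<otimes>\<^bsub>G\<^esub> x) ` S"
      then obtain s where s: "s \<in> S" "s \<in> carrier G" "x = inv\<^bsub>G\<^esub> a \<otimes>\<^bsub>G\<^esub> s" using S_sub by blast
      then have "a \<otimes>\<^bsub>G\<^esub> x = s" using a by (simp add: m_assoc[symmetric])
      then show "x \<in> (\<lambda>x. a \<otimes>\<^bsub>G\<^esub> x) -` S \<inter> space M" using s a by (simp add: sp)
    qed
    then show "emeasure (distr M M (\<lambda>x. a \<otimes>\<^bsub>G\<^esub> x)) S = emeasure M S"
      using S a by (simp add: emeasure_distr[OF meas] left_inv)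
  qed simp
  then show ?thesis using integral_distr[OF meas f] by simp
qed

text \<open>
  By left invariance the columns of the matrix of integrals are vectors fixed by the whole
  representation. The fixed vectors form an invariant subspace, so if there is a nonzero one
  then irreducibility makes every vector fixed.
\<close>

lemma irreducible_rep_trivial_of_integral_nonzero:
  assumes G: "compact_lie_group G" and M: "normalized_haar_measure G M"
    and irr: "irreducible_unitary_rep G d \<xi>"
    and kl: "k < d" "l < d" and nz: "(LINT x|M. \<xi> x $$ (k, l)) \<noteq> 0"
    and x: "x \<in> carrier G"
  shows "\<xi> x = 1\<^sub>m d"
proof -
  have car: "\<And>x. x \<in> carrier G \<Longrightarrow> \<xi> x \<in> carrier_mat d d"
    and hom: "\<And>x y. x \<in> carrier G \<Longrightarrow> y \<in> carrier G \<Longrightarrow> \<xi> (x \<otimes>\<^bsub>G\<^esub> y) = \<xi> x * \<xi> y"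
    and cont: "\<And>i j. i < d \<Longrightarrow> j < d \<Longrightarrow>
      continuous_map (top_of G) euclidean (\<lambda>x. \<xi> x $$ (i, j))"
    and sub: "\<And>W. VectorSpace.subspace class_ring W (module_vec TYPE(complex) d) \<Longrightarrow>
         (\<forall>x\<in>carrier G. \<forall>w\<in>W. \<xi> x *\<^sub>v w \<in> W) \<Longrightarrow> W = {0\<^sub>v d} \<or> W = carrier_vec d"
    using irr by (auto simp: irreducible_unitary_rep_def continuous_unitary_rep_def)
  have sp: "space M = carrier G" using M by (simp add: normalized_haar_measure_def)
  define v where "v = vec d (\<lambda>i. LINT x|M. \<xi> x $$ (i, l))"
  define W where "W = {w \<in> carrier_vec d. \<forall>x\<in>carrier G. \<xi> x *\<^sub>v w = w}"
  have "v \<in> W"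
  proof -
    have "\<xi> a *\<^sub>v v = v" if a: "a \<in> carrier G" for a
    proof (rule eq_vecI)
      fix i assume "i < dim_vec v"
      then have i: "i < d" by (simp add: v_def)
      have "(\<xi> a *\<^sub>v v) $ i = (\<Sum>j<d. \<xi> a $$ (i, j) * (LINT x|M. \<xi> x $$ (j, l)))"
        using i car[OF a] by (simp add: scalar_prod_def v_def lessThan_atLeast0)
      also have "\<dots> = (LINT x|M. (\<Sum>j<d. \<xi> a $$ (i, j) * \<xi> x $$ (j, l)))"
        using continuous_map_integrable_haar[OF G M cont] kl by simp
      also have "\<dots> = (LINT x|M. \<xi> (a \<otimes>\<^bsub>G\<^esub> x) $$ (i, l))"
      proof (rule Bochner_Integration.integral_cong[OF refl])
        fix x assume "x \<in> space M"
        then have x: "x \<in> carrier G" by (simp add: sp)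
        show "(\<Sum>j<d. \<xi> a $$ (i, j) * \<xi> x $$ (j, l)) = \<xi> (a \<otimes>\<^bsub>G\<^esub> x) $$ (i, l)"
          using car[OF a] car[OF x] i kl
          by (simp add: hom[OF a x] scalar_prod_def lessThan_atLeast0)
      qed
      also have "\<dots> = (LINT x|M. \<xi> x $$ (i, l))"
        by (rule haar_integral_left_translate[OF G M a])
          (rule continuous_map_borel_measurable_haar[OF G M cont[OF i kl(2)]])
      finally show "(\<xi> a *\<^sub>v v) $ i = v $ i" using i by (simp add: v_def)
    qed (use car[OF a] in \<open>simp add: v_def\<close>)
    then show ?thesis by (simp add: W_def v_def)
  qed
  moreover have "v \<noteq> 0\<^sub>v d"
  proof
    assume "v = 0\<^sub>v d"
    then have "v $ k = 0" using kl by simp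
    then show False using nz kl by (simp add: v_def)
  qed
  moreover have "W = {0\<^sub>v d} \<or> W = carrier_vec d"
  proof (rule sub)
    have zero: "\<xi> x *\<^sub>v 0\<^sub>v d = 0\<^sub>v d" if "x \<in> carrier G" for x
      using car[OF that] by (intro eq_vecI) auto
    show "VectorSpace.subspace class_ring W (module_vec TYPE(complex) d)"
      unfolding VectorSpace.subspace_def submodule_def
    proof (intro conjI allI impI vec_vs)
      show "module class_ring (module_vec TYPE(complex) d)" by (rule vec_module)
    qed (auto simp: W_def module_vec_simps class_ring_simps zero
        mult_add_distrib_mat_vec[OF car] mult_mat_vec[OF car])
    show "\<forall>x\<in>carrier G. \<forall>w\<in>W. \<xi> x *\<^sub>v w \<in> W" by (auto simp: W_def)
  qed
  ultimately have "W = carrier_vec d" by blast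
  then have "\<xi> x *\<^sub>v w = w" if "w \<in> carrier_vec d" for w using that x by (auto simp: W_def)
  then have fixed: "\<xi> x *\<^sub>v unit_vec d j = unit_vec d j" for j by simp
  show ?thesis
  proof (rule eq_matI)
    fix i j assume "i < dim_row (1\<^sub>m d :: complex mat)" "j < dim_col (1\<^sub>m d :: complex mat)"
    then have ij: "i < d" "j < d" by auto
    then have "\<xi> x $$ (i, j) = (\<xi> x *\<^sub>v unit_vec d j) $ i"
      using car[OF x] by (simp add: scalar_prod_right_unit)
    then show "\<xi> x $$ (i, j) = 1\<^sub>m d $$ (i, j)"
      unfolding fixed using ij by (simp add: unit_vec_def)
  qed (use car[OF x] in auto)
qed

lemma rep_eigenvalue_trivial:
  assumes G: "compact_lie_group G" and d: "0 < d"
    and triv: "\<And>x. x \<in> carrier G \<Longrightarrow> \<xi> x = 1\<^sub>m d"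
  shows "rep_eigenvalue G g d \<xi> = 0"
proof -
  interpret group G using G by (simp add: compact_lie_group_def)
  have L: "laplace_beltrami G g (\<lambda>y. \<xi> y $$ (i, j)) x = 0" if "x \<in> carrier G" for x i j
    by (rule laplace_beltrami_constant[OF G that, of _ "1\<^sub>m d $$ (i, j)"]) (simp add: triv)
  show ?thesis
    unfolding rep_eigenvalue_def
  proof (rule the_equality)
    fix l :: real
    assume "0 \<le> l \<and> (\<forall>i<d. \<forall>j<d. \<forall>x\<in>carrier G.
      - laplace_beltrami G g (\<lambda>y. \<xi> y $$ (i, j)) x = complex_of_real (l\<^sup>2) * \<xi> x $$ (i, j))"
    then have "- laplace_beltrami G g (\<lambda>y. \<xi> y $$ (0, 0)) \<one>\<^bsub>G\<^esub> =
        complex_of_real (l\<^sup>2) * \<xi> \<one>\<^bsub>G\<^esub> $$ (0, 0)"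
      using d by blast
    then show "l = 0" using d by (simp add: L triv)
  qed (simp add: L)
qed

text \<open>
  A nontrivial irreducible representation has integral zero, so it does not see constants; the
  trivial one sees them, but its eigenvalue is zero.
\<close>

lemma frac_laplacian_constant:
  assumes G: "compact_lie_group G" and M: "normalized_haar_measure G M"
  shows "frac_laplacian G M g s (\<lambda>_. c) (\<lambda>_. 0)"
proof -
  interpret prob_space M using M by (simp add: normalized_haar_measure_def)
  have sp: "space M = carrier G" using M by (simp add: normalized_haar_measure_def)
  have "complex_of_real (rep_eigenvalue G g d \<xi> powr (2 * s)) *
      (LINT x|M. c * mat_adjoint (\<xi> x) $$ (i, j)) = 0"
    if irr: "irreducible_unitary_rep G d \<xi>" and ij: "i < d" "j < d" for d \<xi> i j
  proof (cases "(LINT x|M. \<xi> x $$ (j, i)) = 0")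
    case True
    have "(LINT x|M. c * mat_adjoint (\<xi> x) $$ (i, j)) = (LINT x|M. c * cnj (\<xi> x $$ (j, i)))"
    proof (rule Bochner_Integration.integral_cong[OF refl])
      fix x assume "x \<in> space M"
      then have "\<xi> x \<in> carrier_mat d d"
        using irr by (simp add: sp irreducible_unitary_rep_def continuous_unitary_rep_def)
      then show "c * mat_adjoint (\<xi> x) $$ (i, j) = c * cnj (\<xi> x $$ (j, i))"
        using ij by (simp add: mat_adjoint_def mat_of_rows_def conjugate_complex_def)
    qed
    also have "\<dots> = c * cnj (LINT x|M. \<xi> x $$ (j, i))" by (simp del: True)
    finally show ?thesis using True by simp
  next
    case False
    then have "\<xi> x = 1\<^sub>m d" if "x \<in> carrier G" for x
      using irreducible_rep_trivial_of_integral_nonzero[OF G M irr ij(2,1)] that by blast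
    then have "rep_eigenvalue G g d \<xi> = 0"
      using irr by (intro rep_eigenvalue_trivial[OF G]) (auto simp: irreducible_unitary_rep_def)
    then show ?thesis by simp
  qed
  then show ?thesis
    unfolding frac_laplacian_def in_L2_def fourier_coeff_def
    by (auto intro!: eq_matI)
qed

section \<open>Test functions depending on time only\<close>

lemma Ck_on_first_coordinate:
  "Ck_real k h \<Longrightarrow> Ck_on n k S (\<lambda>z. complex_of_real (h (z 0)))"
proof (induction k arbitrary: h)
  have cont: "continuous_map (subtopology (Euclidean_space n) S) euclidean
      (\<lambda>z. complex_of_real (h (z 0)))" if "continuous_on UNIV h" for h
  proof -
    have "continuous_map (powertop_real UNIV) euclideanreal (\<lambda>z. z 0)"
      by (metis UNIV_I continuous_map_product_coordinates)
    moreover have "continuous_map euclideanreal euclidean (\<lambda>x. complex_of_real (h x))"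
      using that by (auto intro!: continuous_intros)
    ultimately have "continuous_map (powertop_real UNIV) euclidean
        ((\<lambda>x. complex_of_real (h x)) \<circ> (\<lambda>z. z 0))"
      by (rule continuous_map_compose)
    then show ?thesis
      unfolding comp_def Euclidean_space_def by (intro continuous_map_from_subtopology)
  qed
  {
    case 0
    then show ?case using cont by simp
  next
    case (Suc k)
    from Suc.prems obtain h' where
      h': "\<And>x. (h has_real_derivative h' x) (at x)" "Ck_real k h'" by auto
    have deriv0: "((\<lambda>t. complex_of_real (h t)) has_vector_derivative complex_of_real (h' x)) (at x)"
      for x
      using h'(1) has_real_derivative_iff_has_vector_derivative has_vector_derivative_of_real by blast
    have "(\<forall>z\<in>S. (\<lambda>t. complex_of_real (h ((z(i := t)) 0))) differentiable (at (z i))) \<and>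
        Ck_on n k S (partial_deriv i (\<lambda>z. complex_of_real (h (z 0))))" for i
    proof (cases "i = 0")
      case True
      have "partial_deriv i (\<lambda>z. complex_of_real (h (z 0))) = (\<lambda>z. complex_of_real (h' (z 0)))"
        using deriv0 by (simp add: True partial_deriv_def vector_derivative_at fun_eq_iff)
      then show ?thesis
        using Suc.IH[OF h'(2)] deriv0 True
        by (auto intro: differentiableI_vector)
    next
      case False
      then have "partial_deriv i (\<lambda>z. complex_of_real (h (z 0))) = (\<lambda>z. complex_of_real 0)"
        by (simp add: partial_deriv_def fun_eq_iff)
      then show ?thesis using Suc.IH[OF Ck_real_const[of k 0]] False by simp
    qed
    then show ?case using cont[OF Ck_real_continuous[OF Suc.prems]] by simp
  }
qed

lemma compactin_time_slab:
  assumes G: "compact_lie_group G" and b: "ereal b < T"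
  shows "compactin (prod_topology (top_of_set (time_interval T)) (top_of G)) ({0..b} \<times> carrier G)"
proof -
  have "{0..b} \<subseteq> time_interval T"
    using b by (auto simp: time_interval_def) (meson ereal_less_eq(3) le_less_trans)
  moreover have "compactin (top_of G) (carrier G)"
    using G by (metis compact_lie_group_def compact_space_def)
  ultimately show ?thesis by (auto simp: compactin_Times compactin_subtopology)
qed

lemma test_function_of_time:
  assumes G: "compact_lie_group G" and \<theta>: "\<And>k. Ck_real k \<theta>"
    and b: "ereal b < T" "\<And>s. b \<le> s \<Longrightarrow> \<theta> s = 0"
  shows "test_function G T (\<lambda>t _. complex_of_real (\<theta> t))"
  unfolding test_function_def smooth_on_coords_def
proof (intro conjI ballI allI)
  show "\<exists>K. compactin (prod_topology (top_of_set (time_interval T)) (top_of G)) K \<and>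
      (\<forall>t\<in>time_interval T. \<forall>x\<in>carrier G. (t, x) \<notin> K \<longrightarrow> complex_of_real (\<theta> t) = 0)"
    using compactin_time_slab[OF G b(1)] b(2)
    by (intro exI[of _ "{0..b} \<times> carrier G"]) (auto simp: time_interval_def)
qed (rule Ck_on_first_coordinate[OF \<theta>])

text \<open>
  The weight \<open>\<tau> - s\<close> is the solution of the backward problem \<open>\<theta>'' = 0\<close>, \<open>\<theta>(\<tau>) = 0\<close>,
  \<open>\<theta>'(\<tau>) = -1\<close>, so that the identity at time \<open>\<tau>\<close> yields the mean of \<open>u(\<tau>)\<close>
  without any derivative of \<open>u\<close>. The cutoff happens after \<open>\<tau>\<close> and leaves no trace.
\<close>

lemma backward_test_function_exists:
  fixes G :: "'a lie_group"
  assumes G: "compact_lie_group G" and \<tau>: "ereal \<tau> < T"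
  shows "\<exists>\<phi>. test_function G T (\<lambda>t (_ :: 'a). \<phi> t) \<and>
    (\<forall>s\<le>\<tau>. \<phi> s = complex_of_real (\<tau> - s)) \<and>
    (\<forall>s\<le>\<tau>. \<forall>x :: 'a. dt (\<lambda>t _. \<phi> t) s x = - 1 \<and> dt (dt (\<lambda>t _. \<phi> t)) s x = 0)"
proof -
  obtain b where b: "\<tau> < b" "ereal b < T" using ereal_dense2[OF \<tau>] by auto
  define a where "a = (\<tau> + b) / 2"
  have a: "\<tau> < a" "a < b" using b by (auto simp: a_def)
  obtain \<eta> where \<eta>: "\<And>k. Ck_real k \<eta>" "\<And>s. s \<le> a \<Longrightarrow> \<eta> s = 1" "\<And>s. b \<le> s \<Longrightarrow> \<eta> s = 0"
    using smooth_cutoff_exists[OF a(2)] by blast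
  define \<theta> where "\<theta> s = ((- 1) * s + \<tau>) * \<eta> s" for s
  define \<phi> where "\<phi> s = complex_of_real (\<theta> s)" for s
  have "Ck_real k \<theta>" for k
    unfolding \<theta>_def by (rule Ck_real_mult[OF Ck_real_affine \<eta>(1)])
  then have "test_function G T (\<lambda>t _. \<phi> t)"
    unfolding \<phi>_def by (rule test_function_of_time[OF G _ b(2)]) (simp add: \<theta>_def \<eta>(3))
  moreover have \<phi>: "\<phi> s = complex_of_real (\<tau> - s)" if "s < a" for s
    using that by (simp add: \<phi>_def \<theta>_def \<eta>(2))
  moreover have d1: "dt (\<lambda>t _. \<phi> t) s x = - 1" if "s < a" for s and x :: 'a
  proof -
    have "((\<lambda>t. complex_of_real (\<tau> - t)) has_vector_derivative complex_of_real (- 1)) (at s)"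
      by (intro has_vector_derivative_of_real) (auto intro!: derivative_eq_intros)
    then have "(\<phi> has_vector_derivative complex_of_real (- 1)) (at s)"
      by (rule has_vector_derivative_transform_within_open[of _ _ _ "{..<a}"])
        (use that \<phi> in auto)
    then show ?thesis by (simp add: dt_def vector_derivative_at)
  qed
  moreover have "dt (dt (\<lambda>t _. \<phi> t)) s x = 0" if "s < a" for s and x :: 'a
  proof -
    have "((\<lambda>_. - 1) has_vector_derivative (0 :: complex)) (at s)" by simp
    then have "((\<lambda>t. dt (\<lambda>t _. \<phi> t) t x) has_vector_derivative 0) (at s)"
      by (rule has_vector_derivative_transform_within_open[of _ _ _ "{..<a}"])
        (use that d1 in auto)
    then show ?thesis by (subst dt_def) (rule vector_derivative_at)
  qed
  ultimately show ?thesis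
    using a(1) by (intro exI[of _ \<phi>] conjI allI impI) (assumption | simp)+
qed

section \<open>The mean of an energy solution\<close>

lemma in_L2_integrable:
  assumes "prob_space M" "in_L2 M f"
  shows "integrable M f"
proof -
  interpret prob_space M by fact
  show ?thesis
  proof (rule Bochner_Integration.integrable_bound)
    show "integrable M (\<lambda>x. 1 + (norm (f x))\<^sup>2)" "f \<in> borel_measurable M"
      using assms(2) by (auto simp: in_L2_def)
    have "y \<le> 1 + y\<^sup>2" for y :: real
      using zero_le_power2[of "y - 1 / 2"] by (simp add: power2_eq_square algebra_simps)
    then show "AE x in M. norm (f x) \<le> norm (1 + (norm (f x))\<^sup>2)" by simp
  qed
qed

text \<open>
  Tested against functions of time alone, the equation loses its operator, since
  \<open>(-L)^\<alpha>\<close> annihilates constants. What remains is the ordinary differential equation for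
  the mean of \<open>u\<close>, integrated twice.
\<close>

lemma energy_solution_mean_identity:
  assumes G: "compact_lie_group G" and M: "normalized_haar_measure G M"
    and u: "energy_solution G M g \<alpha> p \<epsilon> u0 u1 T u"
    and \<tau>: "0 < \<tau>" "ereal \<tau> < T"
  shows "(LINT x|M. u \<tau> x) =
    \<epsilon> * (LINT x|M. u0 x) + \<epsilon> * \<tau> * (LINT x|M. u1 x) +
    complex_of_real (LINT s:{0..\<tau>}|lborel. (\<tau> - s) * (LINT x|M. norm (u s x) powr p))"
proof -
  obtain \<phi> where test: "test_function G T (\<lambda>t _. \<phi> t)"
    and \<phi>: "\<And>s. s \<le> \<tau> \<Longrightarrow> \<phi> s = complex_of_real (\<tau> - s)"
    and d1: "\<And>s x. s \<le> \<tau> \<Longrightarrow> dt (\<lambda>t (_ :: 'a). \<phi> t) s x = - 1"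
    and d2: "\<And>s x. s \<le> \<tau> \<Longrightarrow> dt (dt (\<lambda>t (_ :: 'a). \<phi> t)) s x = 0"
    using backward_test_function_exists[OF G \<tau>(2)] by metis
  obtain w where w: "\<And>\<phi> \<psi> t. test_function G T \<phi> \<Longrightarrow>
      (\<forall>s\<in>time_interval T. frac_laplacian G M g \<alpha> (\<phi> s) (\<psi> s)) \<Longrightarrow> 0 < t \<Longrightarrow> ereal t < T \<Longrightarrow>
          (LINT x|M. w t x * \<phi> t x) - (LINT x|M. u t x * dt \<phi> t x)
          + complex_of_real \<epsilon> * (LINT x|M. u0 x * dt \<phi> 0 x)
          - complex_of_real \<epsilon> * (LINT x|M. u1 x * \<phi> 0 x)
          + (LINT s:{0..t}|lborel. (LINT x|M. u s x * (dt (dt \<phi>) s x + \<psi> s x)))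
          = (LINT s:{0..t}|lborel. (LINT x|M. complex_of_real (norm (u s x) powr p) * \<phi> s x))"
    using u unfolding energy_solution_def by blast
  have "(LINT s:{0..\<tau>}|lborel. (LINT x|M. u s x * (dt (dt (\<lambda>t _. \<phi> t)) s x + 0))) =
      (LINT s:{0..\<tau>}|lborel. 0)"
    by (rule set_lebesgue_integral_cong) (auto simp: d2)
  moreover have "(LINT s:{0..\<tau>}|lborel. (LINT x|M. complex_of_real (norm (u s x) powr p) * \<phi> s)) =
      complex_of_real (LINT s:{0..\<tau>}|lborel. (\<tau> - s) * (LINT x|M. norm (u s x) powr p))"
    unfolding set_integral_complex_of_real[symmetric]
    by (rule set_lebesgue_integral_cong) (auto simp: \<phi>)
  moreover have "(LINT x|M. w \<tau> x * \<phi> \<tau>) - (LINT x|M. u \<tau> x * dt (\<lambda>t _. \<phi> t) \<tau> x)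
          + complex_of_real \<epsilon> * (LINT x|M. u0 x * dt (\<lambda>t _. \<phi> t) 0 x)
          - complex_of_real \<epsilon> * (LINT x|M. u1 x * \<phi> 0)
          + (LINT s:{0..\<tau>}|lborel. (LINT x|M. u s x * (dt (dt (\<lambda>t _. \<phi> t)) s x + 0)))
          = (LINT s:{0..\<tau>}|lborel. (LINT x|M. complex_of_real (norm (u s x) powr p) * \<phi> s))"
    by (rule w[OF test _ \<tau>, of "\<lambda>_ _. 0"]) (intro ballI frac_laplacian_constant[OF G M])
  ultimately show ?thesis
    using \<tau> by (simp add: \<phi> d1 eq_diff_eq diff_eq_eq add_ac mult_ac)
qed

lemma Lp_loc_time_slices:
  assumes G: "compact_lie_group G" and M: "normalized_haar_measure G M"
    and u: "Lp_loc G M p T u" and \<tau>: "ereal \<tau> < T"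
  shows "set_integrable lborel {0..\<tau>} (\<lambda>s. LINT x|M. norm (u s x) powr p)"
    and "AE s in lborel. s \<in> {0..\<tau>} \<longrightarrow> integrable M (\<lambda>x. norm (u s x) powr p)"
proof -
  interpret M: prob_space M using M by (simp add: normalized_haar_measure_def)
  interpret P: pair_sigma_finite lborel M ..
  have sp: "space M = carrier G" using M by (simp add: normalized_haar_measure_def)
  let ?F = "\<lambda>(s, x). indicat_real {0..\<tau>} s * norm (u s x) powr p"
  have "set_integrable (lborel \<Otimes>\<^sub>M M) ({0..\<tau>} \<times> carrier G) (\<lambda>(t, x). norm (u t x) powr p)"
    using u compactin_time_slab[OF G \<tau>] by (simp add: Lp_loc_def)
  then have F: "integrable (lborel \<Otimes>\<^sub>M M) ?F"
    unfolding set_integrable_def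
    by (rule Bochner_Integration.integrable_cong[THEN iffD1, rotated -1])
      (auto simp: space_pair_measure sp indicator_def)
  show "set_integrable lborel {0..\<tau>} (\<lambda>s. LINT x|M. norm (u s x) powr p)"
    using P.integrable_fst'[OF F] by (simp add: set_integrable_def)
  show "AE s in lborel. s \<in> {0..\<tau>} \<longrightarrow> integrable M (\<lambda>x. norm (u s x) powr p)"
    using P.AE_integrable_fst'[OF F] by (auto elim!: eventually_mono)
qed

lemma powr_ge_tangent:
  fixes m p y :: real
  assumes "1 < p" "0 < m" "0 \<le> y"
  shows "m powr p + p * m powr (p - 1) * (y - m) \<le> y powr p"
proof (cases "y = 0")
  case True
  have "m powr (p - 1) * m = m powr p" using assms by (simp add: powr_diff)
  moreover have "1 * m powr p \<le> p * m powr p" using assms by (intro mult_right_mono) auto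
  ultimately show ?thesis using True assms by (simp add: algebra_simps)
next
  case False
  have "y powr p - m powr p \<ge> (p * m powr (p - 1)) * (y - m)"
  proof (rule convex_on_imp_above_tangent[where A = "{0<..}"])
    show "convex_on {0<..} (\<lambda>x. x powr p)" using assms by (intro powr_convex) auto
    show "((\<lambda>x. x powr p) has_field_derivative p * m powr (p - 1)) (at m within {0<..})"
      by (rule has_field_derivative_at_within[OF has_real_derivative_powr[OF assms(2)]])
  qed (use assms False in \<open>auto simp: interior_open\<close>)
  then show ?thesis by simp
qed

text \<open>Integrating the tangent line of \<open>y powr p\<close> at \<open>m\<close> gives this case of Jensen's inequality.\<close>

lemma powr_mean_le_mean_powr:
  fixes f :: "'a \<Rightarrow> complex"
  assumes M: "prob_space M" and p: "1 < p" and f: "integrable M f"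
    and fp: "integrable M (\<lambda>x. norm (f x) powr p)"
    and m: "0 < m" "m \<le> Re (LINT x|M. f x)"
  shows "m powr p \<le> (LINT x|M. norm (f x) powr p)"
proof -
  interpret prob_space M by fact
  have "m \<le> (LINT x|M. norm (f x))"
    using m(2) complex_Re_le_cmod[of "LINT x|M. f x"] integral_norm_bound[of M f] by linarith
  then have "m powr p \<le> m powr p + p * m powr (p - 1) * ((LINT x|M. norm (f x)) - m)"
    using p by simp
  also have "\<dots> = (LINT x|M. m powr p + p * m powr (p - 1) * (norm (f x) - m))"
    using f by (simp add: prob_space)
  also have "\<dots> \<le> (LINT x|M. norm (f x) powr p)"
    using f fp powr_ge_tangent[OF p m(1)] by (intro integral_mono) auto
  finally show ?thesis .
qed

text \<open>
  Passing from \<open>t\<close> to \<open>t + h\<close> increases the weight on the old interval, which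
  can only help, and adds the new interval, where the integral of the weight alone is
  \<open>h^2 / 2\<close>. With \<open>c = 0\<close> this is monotonicity.
\<close>

lemma double_time_integral_growth:
  fixes N :: "real \<Rightarrow> real"
  assumes th: "0 \<le> t" "0 \<le> h" and N: "set_integrable lborel {0..t + h} N" "\<And>s. 0 \<le> N s"
    and c: "AE s in lborel. s \<in> {t..t + h} \<longrightarrow> c \<le> N s"
  shows "(LINT s:{0..t}|lborel. (t - s) * N s) + c * h\<^sup>2 / 2 \<le>
    (LINT s:{0..t + h}|lborel. (t + h - s) * N s)"
proof -
  have weighted: "integrable lborel (\<lambda>s. indicator {0..\<tau>} s * ((\<tau> - s) * N s))"
    if \<tau>: "0 \<le> \<tau>" "\<tau> \<le> t + h" for \<tau>
  proof (rule Bochner_Integration.integrable_bound)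
    have N': "integrable lborel (\<lambda>s. indicator {0..t + h} s * N s)"
      using N(1) by (simp add: set_integrable_def)
    then show "integrable lborel (\<lambda>s. \<tau> * (indicator {0..t + h} s * N s))" by simp
    have [measurable]: "(\<lambda>s. indicator {0..t + h} s * N s) \<in> borel_measurable lborel"
      using N' by (rule borel_measurable_integrable)
    have "(\<lambda>s. indicator {0..\<tau>} s * (\<tau> - s) * (indicator {0..t + h} s * N s))
        \<in> borel_measurable lborel"
      by measurable
    also have "(\<lambda>s. indicator {0..\<tau>} s * (\<tau> - s) * (indicator {0..t + h} s * N s)) =
        (\<lambda>s. indicator {0..\<tau>} s * ((\<tau> - s) * N s))"
      using \<tau> by (auto simp: indicator_def)
    finally show "(\<lambda>s. indicator {0..\<tau>} s * ((\<tau> - s) * N s)) \<in> borel_measurable lborel" .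
    show "AE s in lborel. norm (indicator {0..\<tau>} s * ((\<tau> - s) * N s)) \<le>
        norm (\<tau> * (indicator {0..t + h} s * N s))"
      using \<tau> N(2) by (intro AE_I2) (auto simp: indicator_def abs_mult intro!: mult_right_mono)
  qed
  have parabola: "has_bochner_integral lborel (\<lambda>s. (t + h - s) * indicator {t..t + h} s) (h\<^sup>2 / 2)"
  proof -
    have "has_bochner_integral lborel (\<lambda>s. (t + h - s) * indicator {t..t + h} s)
        (- ((t + h - (t + h))\<^sup>2 / 2) - - ((t + h - t)\<^sup>2 / 2))"
      using th
      by (intro has_bochner_integral_FTC_Icc_real[where F = "\<lambda>s. - ((t + h - s)\<^sup>2 / 2)"])
        (auto intro!: derivative_eq_intros continuous_intros simp: field_simps)
    then show ?thesis by simp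
  qed
  have "(LINT s:{0..t}|lborel. (t - s) * N s) + c * h\<^sup>2 / 2 =
      (LINT s|lborel. indicator {0..t} s * ((t - s) * N s) + c * ((t + h - s) * indicator {t..t + h} s))"
    using th weighted[of t] parabola
    by (simp add: set_lebesgue_integral_def has_bochner_integral_iff)
  also have "\<dots> \<le> (LINT s|lborel. indicator {0..t + h} s * ((t + h - s) * N s))"
  proof (rule integral_mono_AE)
    show "integrable lborel (\<lambda>s. indicator {0..t} s * ((t - s) * N s) +
        c * ((t + h - s) * indicator {t..t + h} s))"
      using th weighted[of t] parabola by (simp add: has_bochner_integral_iff)
    show "integrable lborel (\<lambda>s. indicator {0..t + h} s * ((t + h - s) * N s))"
      using th weighted[of "t + h"] by simp
    show "AE s in lborel. indicator {0..t} s * ((t - s) * N s) +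
        c * ((t + h - s) * indicator {t..t + h} s) \<le> indicator {0..t + h} s * ((t + h - s) * N s)"
      using c
    proof eventually_elim
      case (elim s)
      consider "s < 0" | "0 \<le> s" "s < t" | "0 \<le> s" "t \<le> s" "s \<le> t + h" | "t + h < s" by linarith
      then show ?case
      proof cases
        case 2
        then have "(t - s) * N s \<le> (t + h - s) * N s" using th N(2) by (intro mult_right_mono) auto
        then show ?thesis using 2 th by (simp add: indicator_def)
      next
        case 3
        \<comment> \<open>At the common point \<open>s = t\<close> of the two intervals the first weight \<open>t - s\<close> vanishes.\<close>
        have "c * (t + h - s) \<le> N s * (t + h - s)"
          using 3 elim by (intro mult_right_mono) auto
        then show ?thesis using 3 th by (auto simp: indicator_def mult.commute)
      qed (use th in \<open>auto simp: indicator_def\<close>)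
    qed
  qed
  finally show ?thesis by (simp add: set_lebesgue_integral_def)
qed

section \<open>Finite lifespan\<close>

text \<open>
  Let \<open>V\<close> be the real part of the mean of the solution. It is an affine function with
  nonnegative coefficients plus the double time integral of the mean of \<open>|u|^p\<close>, hence
  nondecreasing. By Jensen's inequality the mean of \<open>|u|^p\<close> is, at almost every time in
  \<open>[t, t + h]\<close>, at least \<open>V t powr p\<close>, which is the growth that forces doubling.
\<close>

lemma energy_solution_existence_time:
  assumes G: "compact_lie_group G" and M: "normalized_haar_measure G M"
    and p: "1 < p" and u: "energy_solution G M g \<alpha> p \<epsilon> u0 u1 T u"
    and a: "a = Re (LINT x|M. u0 x)" "0 \<le> \<epsilon> * a"
    and b: "b = Re (LINT x|M. u1 x)" "0 \<le> \<epsilon> * b"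
    and t0: "0 < t0" and V0: "0 < V0" "V0 \<le> \<epsilon> * a + \<epsilon> * b * t0"
  shows "T \<le> ereal (t0 + 2 / (1 - 2 powr - ((p - 1) / 2)) * V0 powr - ((p - 1) / 2))"
proof (cases "ereal t0 < T")
  case False
  have "2 powr - ((p - 1) / 2) < (1::real)" using p powr_less_mono[of "- ((p - 1) / 2)" 0 2] by simp
  then have "0 \<le> 2 / (1 - 2 powr - ((p - 1) / 2)) * V0 powr - ((p - 1) / 2)" by simp
  then have "ereal t0 \<le> ereal (t0 + 2 / (1 - 2 powr - ((p - 1) / 2)) * V0 powr - ((p - 1) / 2))"
    by simp
  then show ?thesis using False by (meson not_less order_trans)
next
  case True
  have prob: "prob_space M" using M by (simp add: normalized_haar_measure_def)
  have Lp: "Lp_loc G M p T u" and L2: "\<And>t. t \<in> time_interval T \<Longrightarrow> in_L2 M (u t)"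
    using u by (auto simp: energy_solution_def C1_L2_deriv_def)
  define N where "N s = (LINT x|M. norm (u s x) powr p)" for s
  define I where "I t = (LINT s:{0..t}|lborel. (t - s) * N s)" for t
  define V where "V t = Re (LINT x|M. u t x)" for t
  have N_nonneg: "0 \<le> N s" for s by (simp add: N_def)
  have V: "V t = \<epsilon> * a + \<epsilon> * b * t + I t" if "0 < t" "ereal t < T" for t
    using energy_solution_mean_identity[OF G M u that]
    by (simp add: V_def a(1) b(1) I_def N_def)
  have I_growth: "I t + c * h\<^sup>2 / 2 \<le> I (t + h)"
    if "0 \<le> t" "0 \<le> h" "ereal (t + h) < T" "AE s in lborel. s \<in> {t..t + h} \<longrightarrow> c \<le> N s" for t h c
    unfolding I_def using that N_nonneg Lp_loc_time_slices(1)[OF G M Lp that(3)]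
    by (intro double_time_integral_growth) (auto simp: N_def[abs_def])
  have I_mono: "I t \<le> I s" if "0 \<le> t" "t \<le> s" "ereal s < T" for t s
    using I_growth[of t "s - t" 0] that N_nonneg by simp
  have I_nonneg: "0 \<le> I t" for t
    using N_nonneg
    by (auto simp: I_def set_lebesgue_integral_def indicator_def
        intro!: Bochner_Integration.integral_nonneg)
  have growth: "V t + V t powr p * h\<^sup>2 / 2 \<le> V (t + h)"
    if t: "t0 \<le> t" and h: "0 < h" and T: "ereal (t + h) < T" and pos: "0 < V t" for t h
  proof -
    have before: "ereal s < T" if "s \<le> t + h" for s
      using that T by (meson ereal_less_eq(3) le_less_trans)
    have V_mono: "V t \<le> V s" if "t \<le> s" "s \<le> t + h" for s
    proof -
      have "\<epsilon> * b * t \<le> \<epsilon> * b * s" using that b(2) by (intro mult_left_mono) auto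
      then show ?thesis
        using V[of t] V[of s] I_mono[of t s] that t t0 before[of t] before[of s] h by simp
    qed
    have "AE s in lborel. s \<in> {t..t + h} \<longrightarrow> V t powr p \<le> N s"
      using Lp_loc_time_slices(2)[OF G M Lp T]
    proof eventually_elim
      case (elim s)
      show ?case
      proof
        assume s: "s \<in> {t..t + h}"
        then have "s \<in> time_interval T" using before[of s] t t0 by (auto simp: time_interval_def)
        then have "integrable M (u s)" by (intro in_L2_integrable[OF prob] L2)
        then show "V t powr p \<le> N s"
          unfolding N_def using elim s t t0 V_mono[of s]
          by (intro powr_mean_le_mean_powr[OF prob p _ _ pos]) (auto simp: V_def)
      qed
    qed
    then have "I t + V t powr p * h\<^sup>2 / 2 \<le> I (t + h)"
      using t t0 h T by (intro I_growth) auto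
    moreover have "\<epsilon> * b * t \<le> \<epsilon> * b * (t + h)" using h b(2) by (intro mult_left_mono) auto
    ultimately show ?thesis using V[of t] V[of "t + h"] t t0 h T before[of t] by simp
  qed
  show ?thesis
  proof (rule existence_time_le_sum_of_doubling_times[OF p V0(1) _ growth])
    show "V0 \<le> V t0" using V[OF t0 True] V0 I_nonneg[of t0] by simp
  qed
qed

lemma integral_nonneg_Reals:
  fixes f :: "'a \<Rightarrow> complex"
  assumes f: "integrable M f" "AE x in M. f x \<in> \<real>\<^sub>\<ge>\<^sub>0"
  shows "0 \<le> Re (LINT x|M. f x)"
    and "\<not> (AE x in M. f x = 0) \<Longrightarrow> 0 < Re (LINT x|M. f x)"
proof -
  have Re: "AE x in M. 0 \<le> Re (f x)"
    using f(2) by eventually_elim (simp add: complex_nonneg_Reals_iff)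
  have eq: "Re (LINT x|M. f x) = (LINT x|M. Re (f x))" using f(1) by simp
  show nonneg: "0 \<le> Re (LINT x|M. f x)" unfolding eq using Re by (rule integral_nonneg_AE)
  assume nz: "\<not> (AE x in M. f x = 0)"
  have "(LINT x|M. Re (f x)) \<noteq> 0"
  proof
    assume "(LINT x|M. Re (f x)) = 0"
    then have "AE x in M. Re (f x) = 0"
      using integral_nonneg_eq_0_iff_AE[OF _ Re] f(1) by simp
    with f(2) have "AE x in M. f x = 0"
      by eventually_elim (auto simp: complex_nonneg_Reals_iff complex_eq_iff)
    with nz show False by simp
  qed
  then show "0 < Re (LINT x|M. f x)" using nonneg eq by simp
qed

theorem theorem1p4:
  fixes G :: "'a lie_group"
    and M :: "'a measure"
    and g :: "'a metric_components"
    and \<alpha> p :: real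
    and u0 u1 :: "'a \<Rightarrow> complex"
  assumes "compact_lie_group G"
    and "normalized_haar_measure G M"
    and "bi_invariant_metric G g"
    and "0 < \<alpha>" and "\<alpha> < 1" and "1 < p"
    and "in_sobolev G M g \<alpha> u0" and "in_L2 M u1"
    and "AE x in M. u0 x \<in> \<real>\<^sub>\<ge>\<^sub>0" and "AE x in M. u1 x \<in> \<real>\<^sub>\<ge>\<^sub>0"
    and "\<not> ((AE x in M. u0 x = 0) \<and> (AE x in M. u1 x = 0))"
  shows "\<exists>\<epsilon>0>0. \<exists>C>0. \<forall>\<epsilon>. 0 < \<epsilon> \<and> \<epsilon> \<le> \<epsilon>0 \<longrightarrow>
    (\<forall>T u. energy_solution_with_lifespan G M g \<alpha> p \<epsilon> u0 u1 T u \<longrightarrow>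
       T < \<infinity> \<and> T \<le> ereal (C * \<epsilon> powr (- ((p - 1) / lifespan_exponent M u1 p))))"
proof -
  note G = assms(1) and M = assms(2) and p = assms(6)
  have prob: "prob_space M" using M by (simp add: normalized_haar_measure_def)
  have int: "integrable M u0" "integrable M u1"
    using assms(7,8) in_L2_integrable[OF prob] by (auto simp: in_sobolev_def)
  define a where "a = Re (LINT x|M. u0 x)"
  define b where "b = Re (LINT x|M. u1 x)"
  have ab: "0 \<le> a" "0 \<le> b"
    unfolding a_def b_def by (rule integral_nonneg_Reals(1)[OF int(1) assms(9)],
        rule integral_nonneg_Reals(1)[OF int(2) assms(10)])
  define K where "K = 2 / (1 - 2 powr - ((p - 1) / 2))"
  have K: "0 < K"
    using p powr_less_mono[of "- ((p - 1) / 2)" 0 2] by (simp add: K_def)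
  define e where "e = (p - 1) / lifespan_exponent M u1 p"
  \<comment> \<open>\<open>c\<close> is the datum that drives the blow-up and \<open>(\<epsilon> * c) powr - e\<close> the time scale that
    it determines; at this time the affine lower bound reaches the size whose doubling times are
    again of this order.\<close>
  obtain c where c: "0 < c" and bound: "\<And>\<epsilon> T u. 0 < \<epsilon> \<Longrightarrow>
      energy_solution G M g \<alpha> p \<epsilon> u0 u1 T u \<Longrightarrow>
      T \<le> ereal ((1 + K) * (\<epsilon> * c) powr - e)"
  proof (cases "AE x in M. u1 x = 0")
    case True
    then have "0 < a"
      using integral_nonneg_Reals(2)[OF int(1) assms(9)] assms(11) by (auto simp: a_def)
    moreover have e: "e = (p - 1) / 2" using True by (simp add: e_def lifespan_exponent_def)
    moreover have "T \<le> ereal ((1 + K) * (\<epsilon> * a) powr - e)"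
      if \<epsilon>: "0 < \<epsilon>" and u: "energy_solution G M g \<alpha> p \<epsilon> u0 u1 T u" for \<epsilon> T u
    proof -
      have "T \<le> ereal ((\<epsilon> * a) powr - e + K * (\<epsilon> * a) powr - e)"
        unfolding K_def e
        using \<epsilon> ab \<open>0 < a\<close>
        by (intro energy_solution_existence_time[OF G M p u a_def _ b_def]) auto
      then show ?thesis by (simp add: algebra_simps)
    qed
    ultimately show ?thesis using that by blast
  next
    case False
    then have "0 < b" using integral_nonneg_Reals(2)[OF int(2) assms(10)] by (simp add: b_def)
    moreover have e: "e = (p - 1) / (p + 1)"
      using False by (simp add: e_def lifespan_exponent_def)
    moreover have "T \<le> ereal ((1 + K) * (\<epsilon> * b) powr - e)"
      if \<epsilon>: "0 < \<epsilon>" and u: "energy_solution G M g \<alpha> p \<epsilon> u0 u1 T u" for \<epsilon> T u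
    proof -
      let ?t0 = "(\<epsilon> * b) powr - e"
      have eb: "0 < \<epsilon> * b" using \<epsilon> \<open>0 < b\<close> by simp
      have "\<epsilon> * b * ?t0 = (\<epsilon> * b) powr (1 + - e)" using eb by (simp only: powr_add) simp
      also have "1 + - e = 2 / (p + 1)" using p by (simp add: e field_simps)
      finally have "(\<epsilon> * b * ?t0) powr - ((p - 1) / 2) = (\<epsilon> * b) powr (2 / (p + 1) * - ((p - 1) / 2))"
        by (simp only: powr_powr)
      also have "2 / (p + 1) * - ((p - 1) / 2) = - e" using p by (simp add: e field_simps)
      finally have V0: "(\<epsilon> * b * ?t0) powr - ((p - 1) / 2) = ?t0" .
      have "T \<le> ereal (?t0 + K * (\<epsilon> * b * ?t0) powr - ((p - 1) / 2))"
        unfolding K_def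
        using \<epsilon> ab \<open>0 < b\<close>
        by (intro energy_solution_existence_time[OF G M p u a_def _ b_def]) auto
      then show ?thesis unfolding V0 by (simp add: algebra_simps)
    qed
    ultimately show ?thesis using that by blast
  qed
  show ?thesis
  proof (rule exI[of _ 1], rule conjI, simp, rule exI[of _ "(1 + K) * c powr - e"],
      intro conjI allI impI)
    show "0 < (1 + K) * c powr - e" using K c by simp
    fix \<epsilon> T u
    assume "0 < \<epsilon> \<and> \<epsilon> \<le> 1" and u: "energy_solution_with_lifespan G M g \<alpha> p \<epsilon> u0 u1 T u"
    then have \<epsilon>: "0 < \<epsilon>" by simp
    have "T \<le> ereal ((1 + K) * (\<epsilon> * c) powr - e)"
      using bound[OF \<epsilon>] u unfolding energy_solution_with_lifespan_def by blast
    also have "(1 + K) * (\<epsilon> * c) powr - e =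
        (1 + K) * c powr - e * \<epsilon> powr (- ((p - 1) / lifespan_exponent M u1 p))"
      using c \<epsilon> by (simp add: powr_mult e_def)
    finally show T: "T \<le> ereal ((1 + K) * c powr - e *
        \<epsilon> powr (- ((p - 1) / lifespan_exponent M u1 p)))" .
    show "T < \<infinity>" using T by (rule le_less_trans) simp
  qed
qed

end
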